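(* $A$-orbits stratify into the following three families, according to the sign of the (constant) dilational momentum $J$. Let $c:I\to T^*\mathcal H$ be an $A$-orbit, let $t_0<t_1<t_2$ be consecutive zeros of $z(t)$, and let $\lambda=\exp(s(t_2)-s(t_0))$ be its dilation factor. (1) If $J<0$, then $\lambda<1$, and the orbit has a future collision and is unbounded in the past. (2) If $J>0$, then $\lambda>1$, and the orbit has a past collision and is unbounded in the future. (3) If $J=0$, then $\lambda=1$, and the motion is periodic or quasi-periodic.
   Context: Configuration space $\mathcal H$ is $\mathbb R^3$ with coordinates $(x,y,z)$ (the Heisenberg group), with the origin (the location of the sun) excluded. Phase space $T^*\mathcal H$ has canonical coordinates $(x,y,z,p_x,p_y,p_z)$. The Kepler-Heisenberg Hamiltonian is $$H=\tfrac12\big((p_x-\tfrac12 yp_z)^2+(p_y+\tfrac12 xp_z)^2\big)-\frac{1}{8\pi\sqrt{(x^2+y^2)^2+16z^2}}.$$ An $A$-orbit is a solution $c:I\to T^*\mathcal H$ of Hamilton's equations for $H$ on a maximal interval $I$ such that $H=0$ along $c$, the configuration curve $\gamma(t)=(x(t),y(t),z(t))$ does not meet the $z$-axis, and $z(t)$ has at least three discrete (isolated) zeros. The dilational momentum is $J=xp_x+yp_y+2zp_z$; it satisfies $\dot J=2H$, so it is constant along $A$-orbits. The function $s$ is $s=\frac14\log((x^2+y^2)^2+16z^2)$, and $s(t)$ is its value at $c(t)$. Future (resp. past) collision means $\gamma(t)\to(0,0,0)$ as $t\to\sup I$ (resp. $t\to\inf I$). Unbounded in the past (resp. future) means $\gamma$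 is unbounded as $t\to\inf I$ (resp. $t\to\sup I$). For $\lambda>0$, $\delta_\lambda(x,y,z,p_x,p_y,p_z)=(\lambda x,\lambda y,\lambda^2z,\lambda^{-1}p_x,\lambda^{-1}p_y,\lambda^{-2}p_z)$; for $\varphi\in\mathbb R$, $\rho_\varphi$ rotates both $(x,y)$ and $(p_x,p_y)$ by the angle $\varphi$ and fixes $z,p_z$. Quasi-periodic means periodic in time modulo a transformation of space: there are $T>0$, $\varphi\in\mathbb R$ and $\mu>0$ such that for all $t\in I$ one has $t+T\in I$ and $c(t+T)=\rho_\varphi\circ\delta_\mu(c(t))$. *)

theory Defs
  imports "HOL-Analysis.Analysis"
begin

text \<open>A point of phase space is a pair (q, p) with q = (x, y, z) and p = (p_x, p_y, p_z).
  The type also contains the points over q = 0; they are excluded in \<open>hamilton_solution\<close>.\<close>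

type_synonym phase = "(real^3) \<times> (real^3)"

abbreviation x_of :: "phase \<Rightarrow> real" where "x_of w \<equiv> fst w $ 1"
abbreviation y_of :: "phase \<Rightarrow> real" where "y_of w \<equiv> fst w $ 2"
abbreviation z_of :: "phase \<Rightarrow> real" where "z_of w \<equiv> fst w $ 3"
abbreviation px_of :: "phase \<Rightarrow> real" where "px_of w \<equiv> snd w $ 1"
abbreviation py_of :: "phase \<Rightarrow> real" where "py_of w \<equiv> snd w $ 2"
abbreviation pz_of :: "phase \<Rightarrow> real" where "pz_of w \<equiv> snd w $ 3"

definition kh_hamiltonian :: "phase \<Rightarrow> real" where
  "kh_hamiltonian w =
     1/2 * ((px_of w - 1/2 * y_of w * pz_of w)\<^sup>2 + (py_of w + 1/2 * x_of w * pz_of w)\<^sup>2)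
     - 1 / (8 * pi * sqrt (((x_of w)\<^sup>2 + (y_of w)\<^sup>2)\<^sup>2 + 16 * (z_of w)\<^sup>2))"

definition partial_q :: "(phase \<Rightarrow> real) \<Rightarrow> 3 \<Rightarrow> phase \<Rightarrow> real" where
  "partial_q F i w = deriv (\<lambda>h. F (fst w + h *\<^sub>R axis i 1, snd w)) 0"

definition partial_p :: "(phase \<Rightarrow> real) \<Rightarrow> 3 \<Rightarrow> phase \<Rightarrow> real" where
  "partial_p F i w = deriv (\<lambda>h. F (fst w, snd w + h *\<^sub>R axis i 1)) 0"

text \<open>Curves are total functions on the reals; only their values on the open interval I matter.\<close>

definition hamilton_solution :: "real set \<Rightarrow> (real \<Rightarrow> phase) \<Rightarrow> bool" where
  "hamilton_solution I c \<longleftrightarrow>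
     open I \<and> is_interval I \<and> I \<noteq> {} \<and>
     (\<forall>t\<in>I. fst (c t) \<noteq> 0 \<and>
        (\<forall>i. ((\<lambda>u. fst (c u) $ i) has_real_derivative partial_p kh_hamiltonian i (c t)) (at t) \<and>
             ((\<lambda>u. snd (c u) $ i) has_real_derivative - partial_q kh_hamiltonian i (c t)) (at t)))"

definition maximal_hamilton_solution :: "real set \<Rightarrow> (real \<Rightarrow> phase) \<Rightarrow> bool" where
  "maximal_hamilton_solution I c \<longleftrightarrow>
     hamilton_solution I c \<and>
     (\<forall>I' c'. hamilton_solution I' c' \<longrightarrow> I \<subseteq> I' \<longrightarrow> (\<forall>t\<in>I. c' t = c t) \<longrightarrow> I' = I)"

definition z_zeros :: "real set \<Rightarrow> (real \<Rightarrow> phase) \<Rightarrow> real set" where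
  "z_zeros I c = {t \<in> I. z_of (c t) = 0}"

definition isolated_z_zero :: "real set \<Rightarrow> (real \<Rightarrow> phase) \<Rightarrow> real \<Rightarrow> bool" where
  "isolated_z_zero I c t \<longleftrightarrow> t \<in> z_zeros I c \<and> \<not> t islimpt z_zeros I c"

definition A_orbit :: "real set \<Rightarrow> (real \<Rightarrow> phase) \<Rightarrow> bool" where
  "A_orbit I c \<longleftrightarrow>
     maximal_hamilton_solution I c \<and>
     (\<forall>t\<in>I. kh_hamiltonian (c t) = 0) \<and>
     (\<forall>t\<in>I. \<not> (x_of (c t) = 0 \<and> y_of (c t) = 0)) \<and>
     (\<exists>a b d. a < b \<and> b < d \<and>
        isolated_z_zero I c a \<and> isolated_z_zero I c b \<and> isolated_z_zero I c d)"

definition consecutive_z_zeros ::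
    "real set \<Rightarrow> (real \<Rightarrow> phase) \<Rightarrow> real \<Rightarrow> real \<Rightarrow> real \<Rightarrow> bool" where
  "consecutive_z_zeros I c t0 t1 t2 \<longleftrightarrow>
     t0 < t1 \<and> t1 < t2 \<and> z_zeros I c \<inter> {t0..t2} = {t0, t1, t2}"

definition dil_momentum :: "phase \<Rightarrow> real" where
  "dil_momentum w = x_of w * px_of w + y_of w * py_of w + 2 * z_of w * pz_of w"

definition s_fun :: "phase \<Rightarrow> real" where
  "s_fun w = 1/4 * ln (((x_of w)\<^sup>2 + (y_of w)\<^sup>2)\<^sup>2 + 16 * (z_of w)\<^sup>2)"

text \<open>The filters of t tending to sup I and to inf I. The endpoints are taken in the extended reals,
  so that for an unbounded end these are \<open>at_top\<close> and \<open>at_bot\<close>, and for a finite one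
  \<open>at_left (Sup I)\<close> and \<open>at_right (Inf I)\<close>.\<close>

definition future_end :: "real set \<Rightarrow> real filter" where
  "future_end I = filtercomap ereal (at_left (SUP t\<in>I. ereal t))"

definition past_end :: "real set \<Rightarrow> real filter" where
  "past_end I = filtercomap ereal (at_right (INF t\<in>I. ereal t))"

definition future_collision :: "real set \<Rightarrow> (real \<Rightarrow> phase) \<Rightarrow> bool" where
  "future_collision I c \<longleftrightarrow> ((\<lambda>t. fst (c t)) \<longlongrightarrow> 0) (future_end I)"

definition past_collision :: "real set \<Rightarrow> (real \<Rightarrow> phase) \<Rightarrow> bool" where
  "past_collision I c \<longleftrightarrow> ((\<lambda>t. fst (c t)) \<longlongrightarrow> 0) (past_end I)"

definition unbounded_in_future :: "real set \<Rightarrow> (real \<Rightarrow> phase) \<Rightarrow> bool" where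
  "unbounded_in_future I c \<longleftrightarrow> \<not> Bfun (\<lambda>t. fst (c t)) (future_end I)"

definition unbounded_in_past :: "real set \<Rightarrow> (real \<Rightarrow> phase) \<Rightarrow> bool" where
  "unbounded_in_past I c \<longleftrightarrow> \<not> Bfun (\<lambda>t. fst (c t)) (past_end I)"

definition dilation :: "real \<Rightarrow> phase \<Rightarrow> phase" where
  "dilation l w =
     (vector [l * x_of w, l * y_of w, l\<^sup>2 * z_of w],
      vector [px_of w / l, py_of w / l, pz_of w / l\<^sup>2])"

definition rotation :: "real \<Rightarrow> phase \<Rightarrow> phase" where
  "rotation \<phi> w =
     (vector [cos \<phi> * x_of w - sin \<phi> * y_of w, sin \<phi> * x_of w + cos \<phi> * y_of w, z_of w],
      vector [cos \<phi> * px_of w - sin \<phi> * py_of w, sin \<phi> * px_of w + cos \<phi> * py_of w, pz_of w])"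

definition periodic_motion :: "real set \<Rightarrow> (real \<Rightarrow> phase) \<Rightarrow> bool" where
  "periodic_motion I c \<longleftrightarrow> (\<exists>T>0. \<forall>t\<in>I. t + T \<in> I \<and> c (t + T) = c t)"

definition quasi_periodic_motion :: "real set \<Rightarrow> (real \<Rightarrow> phase) \<Rightarrow> bool" where
  "quasi_periodic_motion I c \<longleftrightarrow>
     (\<exists>T>0. \<exists>\<phi>. \<exists>\<mu>>0. \<forall>t\<in>I. t + T \<in> I \<and> c (t + T) = rotation \<phi> (dilation \<mu> (c t)))"

end

theory Submission
  imports Defs
begin

text \<open>
  Write \<open>r\<^sup>2 = x\<^sup>2 + y\<^sup>2\<close>, let \<open>\<rho>\<close> be the homogeneous norm \<open>exp s\<close>, so that \<open>\<rho>\<^sup>4 = r\<^sup>4 + 16 z\<^sup>2\<close>, and let P be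
  the angular momentum. Along a motion of zero energy J and P are constant and \<open>s' = (J r\<^sup>2 + 4 P z) / \<rho>\<^sup>4\<close>. The
  numerator, called drift below, can change sign, so \<open>s\<close> itself is not monotone; the task is to see that nevertheless the
  sign of J decides over a full oscillation of z.

  The condition \<open>H = 0\<close> puts the drift and a companion quantity, the swing, on a circle, and the cosine
  \<open>c = swing / scale\<close> of the resulting angle moves at a rate that also contains the drift as a factor:
  \<open>c' = - s' * turning\<close>. Hence \<open>V = s + \<Omega> c\<close> satisfies \<open>V' = s' * (1 - \<Omega>' c * turning)\<close> for
  every function \<open>\<Omega>\<close>. Say \<open>J \<ge> 0\<close> and \<open>P > 0\<close>. While the drift is negative, c determines
  the reduced state, so \<open>\<Omega>'\<close> can be chosen as the reciprocal of turning there, which makes \<open>V' = 0\<close>. While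
  the drift is positive, turning is at most what it is at the state with the same c and negative drift, so
  \<open>V' \<ge> 0\<close> (\<open>comparison_weight_pos\<close>). The other signs of J and P follow from time reversal and
  reflection; for \<open>P = 0\<close> the drift has the sign of J and \<open>V = s\<close> will do. Thus V is
  monotone in the direction given by the sign of J, it is constant for \<open>J = 0\<close>, and \<open>V - s\<close> is a bounded
  function of the state up to similarity (\<open>lyapunov_function\<close>).

  At a zero of z, the position, J, P and the velocity of z determine the state, and the energy determines the square of
  that velocity; since z, where this velocity is not 0, crosses 0 alternately upwards and downwards, the states at the first and third of three
  consecutive zeros differ by a rotation and a dilation by \<open>\<lambda>\<close> (\<open>twist_returns\<close>,
  \<open>return_similarity\<close>). So \<open>ln \<lambda>\<close> is the increment of V, which settles the position of \<open>\<lambda>\<close> relative to 1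
  (\<open>dilation_sign\<close>).

  Uniqueness of solutions and maximality of the interval spread this one coincidence over the whole motion: the interval
  is mapped into itself by the corresponding rescaling of time, forwards and backwards (\<open>self_similar_motion\<close>). For
  \<open>\<lambda> = 1\<close> this is quasi-periodicity. For \<open>\<lambda> \<noteq> 1\<close> it shows that \<open>s\<close> is unbounded above and below, and the
  monotone V, at bounded distance from \<open>s\<close>, tells at which end of the interval either happens
  (\<open>s_fun_at_ends\<close>).
\<close>

section \<open>Uniqueness of solutions of ordinary differential equations\<close>

text \<open>Gronwall's argument: the squared distance \<open>f\<close> of two solutions satisfies \<open>\<bar>f'\<bar> \<le> 2 L f\<close>, so
  \<open>f t * exp (- 2 L t)\<close> cannot increase after a and \<open>f t * exp (2 L t)\<close> cannot increase towards
  the past; as \<open>f\<close> vanishes at a, it vanishes on both sides.\<close>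

lemma lipschitz_gronwall_step:
  fixes x y :: "real \<Rightarrow> 'a::real_inner"
  assumes "open I" "a \<in> I" "e > 0"
    and x: "\<And>t. t \<in> I \<Longrightarrow> (x has_vector_derivative X (x t)) (at t)"
    and y: "\<And>t. t \<in> I \<Longrightarrow> (y has_vector_derivative X (y t)) (at t)"
    and "x a = y a"
    and L: "L-lipschitz_on (ball (x a) e) X"
  shows "eventually (\<lambda>t. x t = y t) (nhds a)"
proof -
  have near: "eventually (\<lambda>t. z t \<in> ball (x a) e) (nhds a)"
    if "(z has_vector_derivative z') (at a)" "z a = x a" for z :: "real \<Rightarrow> 'a" and z'
  proof -
    have "isCont z a" using that(1) by (rule has_vector_derivative_continuous)
    then have "(z \<longlongrightarrow> x a) (nhds a)"
      using that(2) tendsto_at_iff_tendsto_nhds[of z a] by (simp add: continuous_at)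
    then show ?thesis
      using \<open>e > 0\<close> by (auto dest!: topological_tendstoD[where S="ball (x a) e"])
  qed
  have "eventually (\<lambda>t. x t \<in> ball (x a) e) (nhds a)" "eventually (\<lambda>t. y t \<in> ball (x a) e) (nhds a)"
    using near[OF x[OF \<open>a \<in> I\<close>]] near[OF y[OF \<open>a \<in> I\<close>]] \<open>x a = y a\<close> by simp_all
  moreover have "eventually (\<lambda>t. t \<in> I) (nhds a)"
    using assms(1,2) eventually_nhds by blast
  ultimately have "eventually (\<lambda>t. t \<in> I \<and> x t \<in> ball (x a) e \<and> y t \<in> ball (x a) e) (nhds a)"
    by eventually_elim auto
  then obtain d where "d > 0"
    and d: "\<And>t. dist t a < d \<Longrightarrow> t \<in> I \<and> x t \<in> ball (x a) e \<and> y t \<in> ball (x a) e"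
    by (auto simp: eventually_nhds_metric)
  define f where "f t = (x t - y t) \<bullet> (x t - y t)" for t
  define f' where "f' t = 2 * ((x t - y t) \<bullet> (X (x t) - X (y t)))" for t
  have f: "(f has_real_derivative f' t) (at t)" if "dist t a < d" for t
  proof -
    have "((\<lambda>t. x t - y t) has_vector_derivative X (x t) - X (y t)) (at t)"
      using x y d[OF that] by (intro derivative_intros) auto
    then have *: "((\<lambda>t. x t - y t) has_derivative (\<lambda>h. h *\<^sub>R (X (x t) - X (y t)))) (at t)"
      by (simp add: has_vector_derivative_def)
    have "(f has_derivative (\<lambda>h. h * f' t)) (at t)"
      unfolding f_def f'_def
      by (rule has_derivative_eq_rhs, rule has_derivative_inner[OF * *])
        (auto simp: inner_commute algebra_simps fun_eq_iff)
    then show ?thesis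
      by (simp add: has_field_derivative_def mult.commute[of _ "f' t"])
  qed
  have bound: "\<bar>f' t\<bar> \<le> 2 * L * f t" if "dist t a < d" for t
  proof -
    have "norm (X (x t) - X (y t)) \<le> L * norm (x t - y t)"
      using lipschitz_on_normD[OF L] d[OF that] by blast
    then have "norm (x t - y t) * norm (X (x t) - X (y t)) \<le> norm (x t - y t) * (L * norm (x t - y t))"
      by (rule mult_left_mono) auto
    moreover have "\<bar>(x t - y t) \<bullet> (X (x t) - X (y t))\<bar> \<le> norm (x t - y t) * norm (X (x t) - X (y t))"
      by (rule Cauchy_Schwarz_ineq2)
    ultimately show ?thesis
      by (simp add: f_def f'_def abs_mult power2_norm_eq_inner[symmetric] power2_eq_square algebra_simps)
  qed
  have "x t = y t" if t: "dist t a < d" for t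
  proof -
    have "f t \<le> 0"
    proof (cases "a \<le> t")
      case True
      have "f t * exp (- 2 * L * t) \<le> f a * exp (- 2 * L * a)"
      proof (rule DERIV_nonpos_imp_nonincreasing[OF True])
        fix u assume "a \<le> u" "u \<le> t"
        then have u: "dist u a < d" using t by (auto simp: dist_real_def)
        have "((\<lambda>t. f t * exp (- 2 * L * t)) has_real_derivative (f' u - 2 * L * f u) * exp (- 2 * L * u)) (at u)"
          by (auto intro!: derivative_eq_intros f u simp: algebra_simps)
        moreover have "(f' u - 2 * L * f u) * exp (- 2 * L * u) \<le> 0"
          using bound[OF u] by (intro mult_nonpos_nonneg) auto
        ultimately show "\<exists>z. ((\<lambda>t. f t * exp (- 2 * L * t)) has_real_derivative z) (at u) \<and> z \<le> 0"
          by blast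
      qed
      then have "f t * exp (- 2 * L * t) \<le> 0" using \<open>x a = y a\<close> by (simp add: f_def)
      then show ?thesis by (simp add: mult_le_0_iff)
    next
      case False
      then have "t \<le> a" by simp
      have "f t * exp (2 * L * t) \<le> f a * exp (2 * L * a)"
      proof (rule DERIV_nonneg_imp_nondecreasing[OF \<open>t \<le> a\<close>])
        fix u assume "t \<le> u" "u \<le> a"
        then have u: "dist u a < d" using t by (auto simp: dist_real_def)
        have "((\<lambda>t. f t * exp (2 * L * t)) has_real_derivative (f' u + 2 * L * f u) * exp (2 * L * u)) (at u)"
          by (auto intro!: derivative_eq_intros f u simp: algebra_simps)
        moreover have "(f' u + 2 * L * f u) * exp (2 * L * u) \<ge> 0"
          using bound[OF u] by (intro mult_nonneg_nonneg) auto
        ultimately show "\<exists>z. ((\<lambda>t. f t * exp (2 * L * t)) has_real_derivative z) (at u) \<and> 0 \<le> z"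
          by blast
      qed
      then have "f t * exp (2 * L * t) \<le> 0" using \<open>x a = y a\<close> by (simp add: f_def)
      then show ?thesis by (simp add: mult_le_0_iff)
    qed
    then show ?thesis by (simp add: f_def power2_norm_eq_inner[symmetric])
  qed
  then show ?thesis
    using \<open>d > 0\<close> by (auto simp: eventually_nhds_metric)
qed

text \<open>A pointwise form of local Lipschitz continuity. It is inherited by sums, products and compositions,
  so that a field given by a formula is treated factor by factor.\<close>

definition lipschitz_near :: "('a::metric_space \<Rightarrow> 'b::metric_space) \<Rightarrow> 'a \<Rightarrow> bool" where
  "lipschitz_near f p \<longleftrightarrow> (\<exists>e>0. \<exists>L. L-lipschitz_on (ball p e) f)"

text \<open>The times at which two solutions agree form a closed set by continuity and an open one by the local
  estimate, hence all of the interval as soon as there is one such time.\<close>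

proposition ode_solutions_agree:
  fixes x y :: "real \<Rightarrow> 'a::real_inner"
  assumes "open I" "is_interval I" "a \<in> I" "x a = y a"
    and x: "\<And>t. t \<in> I \<Longrightarrow> (x has_vector_derivative X (x t)) (at t)"
    and y: "\<And>t. t \<in> I \<Longrightarrow> (y has_vector_derivative X (y t)) (at t)"
    and lip: "\<And>t. t \<in> I \<Longrightarrow> lipschitz_near X (x t)"
    and "t \<in> I"
  shows "x t = y t"
proof -
  let ?E = "{t \<in> I. x t = y t}"
  have "open ?E"
    unfolding open_subopen[of ?E]
  proof
    fix u assume "u \<in> ?E"
    then have u: "u \<in> I" "x u = y u" by auto
    have "lipschitz_near X (x u)" using u(1) by (rule lip)
    then obtain e L where "e > 0" "L-lipschitz_on (ball (x u) e) X"
      unfolding lipschitz_near_def by blast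
    then have "eventually (\<lambda>t. x t = y t) (nhds u)"
      using lipschitz_gronwall_step[OF \<open>open I\<close> u(1) _ x y u(2)] by blast
    moreover have "eventually (\<lambda>t. t \<in> I) (nhds u)"
      using u(1) \<open>open I\<close> eventually_nhds by blast
    ultimately have "eventually (\<lambda>t. t \<in> ?E) (nhds u)"
      by eventually_elim simp
    then show "\<exists>T. open T \<and> u \<in> T \<and> T \<subseteq> ?E"
      unfolding eventually_nhds by blast
  qed
  then have "openin (top_of_set I) ?E"
    by (intro open_openin_trans) (use \<open>open I\<close> in auto)
  moreover have "continuous_on I (\<lambda>t. x t - y t)"
    using x y by (intro continuous_intros continuous_at_imp_continuous_on)
      (auto intro: has_vector_derivative_continuous)
  then have "closedin (top_of_set I) {t \<in> I. x t - y t = 0}"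
    by (rule continuous_closedin_preimage_constant)
  ultimately have "?E = {} \<or> ?E = I"
    using \<open>is_interval I\<close> is_interval_connected_1 connected_clopen[of I] by auto
  then show ?thesis using assms by blast
qed

lemma lipschitz_near_continuous:
  assumes "lipschitz_near f p"
  shows "isCont f p"
proof -
  obtain e L where "e > 0" "L-lipschitz_on (ball p e) f"
    using assms unfolding lipschitz_near_def by blast
  then show ?thesis
    using lipschitz_on_continuous_on[of L "ball p e" f] continuous_on_eq_continuous_at[of "ball p e" f]
    by simp
qed

lemma lipschitz_near_const: "lipschitz_near (\<lambda>w. k) p"
  unfolding lipschitz_near_def
  by (intro exI[of _ 1] conjI exI[of _ 0] lipschitz_onI) simp_all

lemma lipschitz_near_linear:
  assumes "bounded_linear f"
  shows "lipschitz_near f p"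
proof -
  obtain B where "B-lipschitz_on (ball p 1) f"
    using bounded_linear.lipschitz_boundE[OF assms] .
  then show ?thesis unfolding lipschitz_near_def using zero_less_one by blast
qed

lemma lipschitz_nearE2:
  assumes "lipschitz_near f p" "lipschitz_near g p"
  obtains e L M where "e > 0" "L-lipschitz_on (ball p e) f" "M-lipschitz_on (ball p e) g"
proof -
  obtain e1 e2 L M where *: "e1 > 0" "e2 > 0" "L-lipschitz_on (ball p e1) f" "M-lipschitz_on (ball p e2) g"
    using assms unfolding lipschitz_near_def by blast
  show ?thesis
  proof (rule that)
    show "min e1 e2 > 0" using * by simp
    show "L-lipschitz_on (ball p (min e1 e2)) f" using *(3) by (rule lipschitz_on_subset) auto
    show "M-lipschitz_on (ball p (min e1 e2)) g" using *(4) by (rule lipschitz_on_subset) auto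
  qed
qed

lemma lipschitz_near_add:
  fixes f g :: "'a::metric_space \<Rightarrow> 'b::real_normed_vector"
  assumes "lipschitz_near f p" "lipschitz_near g p"
  shows "lipschitz_near (\<lambda>w. f w + g w) p"
proof -
  obtain e L M where e: "e > 0" "L-lipschitz_on (ball p e) f" "M-lipschitz_on (ball p e) g"
    using lipschitz_nearE2[OF assms] .
  then show ?thesis using lipschitz_on_add[OF e(2,3)] unfolding lipschitz_near_def by blast
qed

text \<open>Near a point both factors are bounded, since a Lipschitz function moves by at most L e on a ball of
  radius e; the product rule for increments does the rest.\<close>

lemma lipschitz_near_mult:
  fixes f g :: "'a::metric_space \<Rightarrow> real"
  assumes "lipschitz_near f p" "lipschitz_near g p"
  shows "lipschitz_near (\<lambda>w. f w * g w) p"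
proof -
  obtain e L M where e: "e > 0" "L-lipschitz_on (ball p e) f" "M-lipschitz_on (ball p e) g"
    using lipschitz_nearE2[OF assms] .
  note nonneg = lipschitz_on_nonneg[OF e(2)] lipschitz_on_nonneg[OF e(3)]
  have bound: "\<bar>h w\<bar> \<le> \<bar>h p\<bar> + K * e"
    if "K-lipschitz_on (ball p e) h" "w \<in> ball p e" for h :: "'a \<Rightarrow> real" and K w
  proof -
    have "\<bar>h w - h p\<bar> \<le> K * dist w p"
      using lipschitz_onD[OF that(1), of w p] that e(1) by (auto simp: dist_real_def)
    also have "\<dots> \<le> K * e"
      using that lipschitz_on_nonneg[OF that(1)] by (intro mult_left_mono) (auto simp: dist_commute)
    finally show ?thesis by linarith
  qed
  define F where "F = \<bar>f p\<bar> + L * e"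
  define G where "G = \<bar>g p\<bar> + M * e"
  have "0 \<le> F" "0 \<le> G" using nonneg e(1) by (auto simp: F_def G_def)
  have "(F * M + G * L)-lipschitz_on (ball p e) (\<lambda>w. f w * g w)"
  proof (rule lipschitz_onI)
    fix v w assume vw: "v \<in> ball p e" "w \<in> ball p e"
    have "f v * g v - f w * g w = f v * (g v - g w) + g w * (f v - f w)"
      by (simp add: algebra_simps)
    then have "\<bar>f v * g v - f w * g w\<bar> \<le> \<bar>f v\<bar> * \<bar>g v - g w\<bar> + \<bar>g w\<bar> * \<bar>f v - f w\<bar>"
      by (metis abs_mult abs_triangle_ineq)
    also have "\<dots> \<le> F * (M * dist v w) + G * (L * dist v w)"
      using bound[OF e(2) vw(1)] bound[OF e(3) vw(2)] lipschitz_onD[OF e(2) vw] lipschitz_onD[OF e(3) vw]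
        \<open>0 \<le> F\<close> \<open>0 \<le> G\<close>
      unfolding F_def[symmetric] G_def[symmetric]
      by (intro add_mono mult_mono) (auto simp: dist_real_def)
    finally show "dist (f v * g v) (f w * g w) \<le> (F * M + G * L) * dist v w"
      by (simp add: dist_real_def algebra_simps)
  qed (use nonneg \<open>0 \<le> F\<close> \<open>0 \<le> G\<close> in auto)
  then show ?thesis using e(1) unfolding lipschitz_near_def by blast
qed

lemma lipschitz_near_compose:
  assumes "lipschitz_near f p" "lipschitz_near g (f p)"
  shows "lipschitz_near (\<lambda>w. g (f w)) p"
proof -
  obtain d e L M where de: "d > 0" "e > 0" "L-lipschitz_on (ball p d) f" "M-lipschitz_on (ball (f p) e) g"
    using assms unfolding lipschitz_near_def by blast
  have "eventually (\<lambda>w. f w \<in> ball (f p) e) (nhds p)"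
    using lipschitz_near_continuous[OF assms(1)] de(2) tendsto_at_iff_tendsto_nhds[of f p]
    by (auto simp: continuous_at dest!: topological_tendstoD[where S="ball (f p) e"])
  then obtain d' where d': "d' > 0" "\<And>w. dist w p < d' \<Longrightarrow> f w \<in> ball (f p) e"
    by (auto simp: eventually_nhds_metric)
  have "L-lipschitz_on (ball p (min d d')) f"
    using de(3) by (rule lipschitz_on_subset) auto
  moreover have "M-lipschitz_on (f ` ball p (min d d')) g"
    using de(4) by (rule lipschitz_on_subset) (use d' in \<open>auto simp: dist_commute\<close>)
  ultimately have "(M * L)-lipschitz_on (ball p (min d d')) (\<lambda>w. g (f w))"
    by (rule lipschitz_on_compose2)
  moreover have "min d d' > 0" using de(1) d'(1) by simp
  ultimately show ?thesis unfolding lipschitz_near_def by blast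
qed

lemma lipschitz_near_of_bounded_deriv:
  fixes g :: "real \<Rightarrow> real"
  assumes "e > 0" "\<And>r. r \<in> ball p e \<Longrightarrow> (g has_real_derivative g' r) (at r)"
    and "\<And>r. r \<in> ball p e \<Longrightarrow> \<bar>g' r\<bar> \<le> L"
  shows "lipschitz_near g p"
proof -
  have "0 \<le> L" using assms(1) assms(3)[of p] by simp
  have "L-lipschitz_on (ball p e) g"
  proof (rule lipschitz_onI)
    fix x y assume xy: "x \<in> ball p e" "y \<in> ball p e"
    have "norm (g x - g y) \<le> L * norm (x - y)"
      by (rule field_differentiable_bound[where f'=g' and S="ball p e"])
        (use assms xy in \<open>auto simp del: mem_ball intro: has_field_derivative_at_within\<close>)
    then show "dist (g x) (g y) \<le> L * dist x y" by (simp add: dist_norm)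
  qed (fact \<open>0 \<le> L\<close>)
  then show ?thesis using assms(1) unfolding lipschitz_near_def by blast
qed

section \<open>The Kepler-Heisenberg vector field\<close>

definition rsq :: "phase \<Rightarrow> real" where
  "rsq w = (x_of w)\<^sup>2 + (y_of w)\<^sup>2"

text \<open>The fourth power of a norm on configuration space that dilations scale linearly; \<open>s_fun\<close> is the
  logarithm of that norm.\<close>

definition gauge4 :: "phase \<Rightarrow> real" where
  "gauge4 w = (rsq w)\<^sup>2 + 16 * (z_of w)\<^sup>2"

text \<open>The horizontal momenta. They are the velocities of x and y, and half the sum of their squares is the
  kinetic energy.\<close>

definition mom_X :: "phase \<Rightarrow> real" where
  "mom_X w = px_of w - 1/2 * y_of w * pz_of w"

definition mom_Y :: "phase \<Rightarrow> real" where
  "mom_Y w = py_of w + 1/2 * x_of w * pz_of w"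

abbreviation coupling :: real where "coupling \<equiv> 1 / (4 * pi)"

definition kh_field :: "phase \<Rightarrow> phase" where
  "kh_field w =
     (vector [mom_X w, mom_Y w, 1/2 * (x_of w * mom_Y w - y_of w * mom_X w)],
      vector [- (1/2 * pz_of w * mom_Y w) - coupling * x_of w * rsq w / (gauge4 w * sqrt (gauge4 w)),
              1/2 * pz_of w * mom_X w - coupling * y_of w * rsq w / (gauge4 w * sqrt (gauge4 w)),
              - (8 * coupling * z_of w / (gauge4 w * sqrt (gauge4 w)))])"

lemma phase_eq_iff:
  "v = w \<longleftrightarrow> x_of v = x_of w \<and> y_of v = y_of w \<and> z_of v = z_of w \<and>
     px_of v = px_of w \<and> py_of v = py_of w \<and> pz_of v = pz_of w" for v w :: phase
  by (auto simp: prod_eq_iff vec_eq_iff forall_3)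

lemma gauge4_pos: "fst w \<noteq> 0 \<Longrightarrow> 0 < gauge4 w"
proof (rule ccontr)
  assume "fst w \<noteq> 0" "\<not> 0 < gauge4 w"
  then have "rsq w = 0" "z_of w = 0"
    by (auto simp: gauge4_def not_less sum_power2_le_zero_iff[of "rsq w" "4 * z_of w", unfolded power_mult_distrib, simplified])
  then show False using \<open>fst w \<noteq> 0\<close>
    by (simp add: rsq_def sum_power2_eq_zero_iff vec_eq_iff forall_3)
qed

lemma kh_hamiltonian_alt:
  "kh_hamiltonian w = 1/2 * ((mom_X w)\<^sup>2 + (mom_Y w)\<^sup>2) - 1 / (8 * pi * sqrt (gauge4 w))"
  by (simp add: kh_hamiltonian_def mom_X_def mom_Y_def gauge4_def rsq_def)

text \<open>Hamilton's equations written out, so that the solutions become integral curves of an explicit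
  vector field.\<close>

lemma partial_kh_hamiltonian:
  assumes "fst w \<noteq> 0"
  shows "partial_p kh_hamiltonian i w = fst (kh_field w) $ i"
    and "- partial_q kh_hamiltonian i w = snd (kh_field w) $ i"
proof -
  let ?N = "gauge4 w"
  have N: "0 < ?N" using gauge4_pos[OF assms] .
  have N': "0 < ((x_of w)\<^sup>2 + (y_of w)\<^sup>2)\<^sup>2 + 16 * (z_of w)\<^sup>2"
    using N by (simp add: gauge4_def rsq_def)
  have "partial_p kh_hamiltonian 1 w = mom_X w"
    unfolding partial_p_def kh_hamiltonian_def mom_X_def
    by (rule DERIV_imp_deriv) (auto intro!: derivative_eq_intros simp: axis_def)
  moreover have "partial_p kh_hamiltonian 2 w = mom_Y w"
    unfolding partial_p_def kh_hamiltonian_def mom_Y_def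
    by (rule DERIV_imp_deriv) (auto intro!: derivative_eq_intros simp: axis_def)
  moreover have "partial_p kh_hamiltonian 3 w = 1/2 * (x_of w * mom_Y w - y_of w * mom_X w)"
    unfolding partial_p_def kh_hamiltonian_def mom_X_def mom_Y_def
    by (rule DERIV_imp_deriv) (auto intro!: derivative_eq_intros simp: axis_def field_simps)
  ultimately show "partial_p kh_hamiltonian i w = fst (kh_field w) $ i"
    using exhaust_3[of i] by (auto simp: kh_field_def)
  have pot: "((\<lambda>h. 1 / (8 * pi * sqrt (n h))) has_real_derivative - (coupling / 4 * n' / (n 0 * sqrt (n 0)))) (at 0)"
    if "(n has_real_derivative n') (at 0)" "0 < n 0" for n n'
  proof -
    have "sqrt (n 0) * sqrt (n 0) = n 0" using that by simp
    then show ?thesis using that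
      by (auto intro!: derivative_eq_intros simp: divide_simps)
  qed
  have "partial_q kh_hamiltonian 1 w = 1/2 * pz_of w * mom_Y w + coupling / 4 * (4 * x_of w * rsq w) / (?N * sqrt ?N)"
  proof -
    define n where "n h = ((x_of w + h)\<^sup>2 + (y_of w)\<^sup>2)\<^sup>2 + 16 * (z_of w)\<^sup>2" for h
    have n0: "n 0 = ?N" by (simp add: n_def gauge4_def rsq_def)
    have "(n has_real_derivative 4 * x_of w * rsq w) (at 0)"
      unfolding n_def by (auto intro!: derivative_eq_intros simp: rsq_def)
    from pot[OF this] N
    have U: "((\<lambda>h. 1 / (8 * pi * sqrt (n h))) has_real_derivative - (coupling / 4 * (4 * x_of w * rsq w) / (?N * sqrt ?N))) (at 0)"
      by (simp only: n0)
    have K: "((\<lambda>h. 1/2 * ((px_of w - 1/2 * y_of w * pz_of w)\<^sup>2 + (py_of w + 1/2 * (x_of w + h) * pz_of w)\<^sup>2)) has_real_derivative 1/2 * pz_of w * mom_Y w) (at 0)"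
      by (auto intro!: derivative_eq_intros simp: mom_X_def mom_Y_def)
    show ?thesis
      unfolding partial_q_def kh_hamiltonian_def
      by (rule DERIV_imp_deriv) (use DERIV_diff[OF K U] in \<open>simp add: n_def axis_def\<close>)
  qed
  moreover
  have "partial_q kh_hamiltonian 2 w = - (1/2 * pz_of w * mom_X w) + coupling / 4 * (4 * y_of w * rsq w) / (?N * sqrt ?N)"
  proof -
    define n where "n h = ((x_of w)\<^sup>2 + (y_of w + h)\<^sup>2)\<^sup>2 + 16 * (z_of w)\<^sup>2" for h
    have n0: "n 0 = ?N" by (simp add: n_def gauge4_def rsq_def)
    have "(n has_real_derivative 4 * y_of w * rsq w) (at 0)"
      unfolding n_def by (auto intro!: derivative_eq_intros simp: rsq_def)
    from pot[OF this] N
    have U: "((\<lambda>h. 1 / (8 * pi * sqrt (n h))) has_real_derivative - (coupling / 4 * (4 * y_of w * rsq w) / (?N * sqrt ?N))) (at 0)"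
      by (simp only: n0)
    have K: "((\<lambda>h. 1/2 * ((px_of w - 1/2 * (y_of w + h) * pz_of w)\<^sup>2 + (py_of w + 1/2 * x_of w * pz_of w)\<^sup>2)) has_real_derivative - (1/2 * pz_of w * mom_X w)) (at 0)"
      by (auto intro!: derivative_eq_intros simp: mom_X_def mom_Y_def)
    show ?thesis
      unfolding partial_q_def kh_hamiltonian_def
      by (rule DERIV_imp_deriv) (use DERIV_diff[OF K U] in \<open>simp add: n_def axis_def\<close>)
  qed
  moreover
  have "partial_q kh_hamiltonian 3 w = 0 + coupling / 4 * (32 * z_of w) / (?N * sqrt ?N)"
  proof -
    define n where "n h = ((x_of w)\<^sup>2 + (y_of w)\<^sup>2)\<^sup>2 + 16 * (z_of w + h)\<^sup>2" for h
    have n0: "n 0 = ?N" by (simp add: n_def gauge4_def rsq_def)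
    have "(n has_real_derivative 32 * z_of w) (at 0)"
      unfolding n_def by (auto intro!: derivative_eq_intros simp: rsq_def)
    from pot[OF this] N
    have U: "((\<lambda>h. 1 / (8 * pi * sqrt (n h))) has_real_derivative - (coupling / 4 * (32 * z_of w) / (?N * sqrt ?N))) (at 0)"
      by (simp only: n0)
    have K: "((\<lambda>h. 1/2 * ((px_of w - 1/2 * y_of w * pz_of w)\<^sup>2 + (py_of w + 1/2 * x_of w * pz_of w)\<^sup>2)) has_real_derivative 0) (at 0)"
      by (auto intro!: derivative_eq_intros simp: mom_X_def mom_Y_def)
    show ?thesis
      unfolding partial_q_def kh_hamiltonian_def
      by (rule DERIV_imp_deriv) (use DERIV_diff[OF K U] in \<open>simp add: n_def axis_def\<close>)
  qed
  ultimately show "- partial_q kh_hamiltonian i w = snd (kh_field w) $ i"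
    using exhaust_3[of i] by (auto simp: kh_field_def)
qed

lemma hamilton_solution_iff:
  "hamilton_solution I c \<longleftrightarrow> open I \<and> is_interval I \<and> I \<noteq> {} \<and>
     (\<forall>t\<in>I. fst (c t) \<noteq> 0 \<and> (c has_vector_derivative kh_field (c t)) (at t))"
proof -
  have "(c has_vector_derivative v) (at t) \<longleftrightarrow>
      (\<forall>i. ((\<lambda>u. fst (c u) $ i) has_real_derivative fst v $ i) (at t) \<and>
           ((\<lambda>u. snd (c u) $ i) has_real_derivative snd v $ i) (at t))" (is "?L \<longleftrightarrow> ?R") for v t
  proof
    assume L: ?L
    have *: "((\<lambda>u. f (c u)) has_real_derivative f v) (at t)" if "bounded_linear f" for f :: "phase \<Rightarrow> real"
      using bounded_linear.has_vector_derivative[OF that L] by (simp add: has_real_derivative_iff_has_vector_derivative)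
    show ?R
      by (auto intro!: * bounded_linear_compose[OF bounded_linear_vec_nth] bounded_linear_fst bounded_linear_snd)
  next
    assume ?R
    then have "((\<lambda>u. vec_nth (fst (c u)) i) has_vector_derivative fst v $ i) (at t)"
      "((\<lambda>u. vec_nth (snd (c u)) i) has_vector_derivative snd v $ i) (at t)" for i
      by (simp_all add: has_real_derivative_iff_has_vector_derivative)
    then have "((\<lambda>u. (fst (c u))) has_vector_derivative fst v) (at t)"
      "((\<lambda>u. (snd (c u))) has_vector_derivative snd v) (at t)"
      by (auto simp: has_vector_derivative_def has_derivative_componentwise_within[of "\<lambda>u. fst (c u)"]
            has_derivative_componentwise_within[of "\<lambda>u. snd (c u)"] Basis_vec_def inner_axis)
    from has_vector_derivative_Pair[OF this] show ?L by simp
  qed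
  then show ?thesis
    unfolding hamilton_solution_def by (auto simp: partial_kh_hamiltonian)
qed

lemma s_fun_gauge4: "s_fun w = 1/4 * ln (gauge4 w)"
  by (simp add: s_fun_def gauge4_def rsq_def)

section \<open>Maximal solutions and similarities\<close>

lemma lipschitz_near_inverse_three_halves:
  assumes "0 < p"
  shows "lipschitz_near (\<lambda>r. inverse (r * sqrt r)) p"
proof (rule lipschitz_near_of_bounded_deriv)
  fix r assume "r \<in> ball p (p / 2)"
  then have r: "p / 2 \<le> r" "0 < r" using assms by (auto simp: dist_real_def abs_if split: if_splits)
  have [simp]: "sqrt r * sqrt r = r" using r by simp
  show "((\<lambda>r. inverse (r * sqrt r)) has_real_derivative - (3 / (2 * (r * r * sqrt r)))) (at r)"
    using r by (auto intro!: derivative_eq_intros simp: field_simps)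
  have "p / 2 * (p / 2) * sqrt (p / 2) \<le> r * r * sqrt r"
    using r assms by (intro mult_mono) auto
  then have "3 / (2 * (r * r * sqrt r)) \<le> 3 / (2 * (p / 2 * (p / 2) * sqrt (p / 2)))"
    using r assms by (intro divide_left_mono) auto
  then show "\<bar>- (3 / (2 * (r * r * sqrt r)))\<bar> \<le> 3 / (2 * (p / 2 * (p / 2) * sqrt (p / 2)))"
    using r by simp
qed (use assms in simp)

text \<open>Apart from polynomials the field contains only the power -3/2 of \<open>gauge4\<close>, which is harmless away
  from the sun; the field is the sum of its coordinates times fixed vectors.\<close>

lemma kh_field_lipschitz_near:
  assumes "fst w \<noteq> 0"
  shows "lipschitz_near kh_field w"
proof -
  have coord: "lipschitz_near (\<lambda>w::phase. fst w $ i) w" "lipschitz_near (\<lambda>w::phase. snd w $ i) w" for i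
    by (intro lipschitz_near_linear bounded_linear_compose[OF bounded_linear_vec_nth]
        bounded_linear_fst bounded_linear_snd)+
  have diff: "lipschitz_near (\<lambda>w. f w - g w) w"
    if "lipschitz_near f w" "lipschitz_near g w" for f g :: "phase \<Rightarrow> real"
    using lipschitz_near_add[OF that(1) lipschitz_near_mult[OF lipschitz_near_const[of "-1"] that(2)]] by simp
  have neg: "lipschitz_near (\<lambda>w. - f w) w" if "lipschitz_near f w" for f :: "phase \<Rightarrow> real"
    using diff[OF lipschitz_near_const[of 0] that] by simp
  have rsq: "lipschitz_near rsq w"
    unfolding rsq_def power2_eq_square by (intro lipschitz_near_add lipschitz_near_mult coord)
  have "lipschitz_near gauge4 w"
    unfolding gauge4_def power2_eq_square
    by (intro lipschitz_near_add lipschitz_near_mult lipschitz_near_const coord rsq)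
  then have inv: "lipschitz_near (\<lambda>w. inverse (gauge4 w * sqrt (gauge4 w))) w"
    by (rule lipschitz_near_compose[OF _ lipschitz_near_inverse_three_halves]) (rule gauge4_pos[OF assms])
  have XY: "lipschitz_near mom_X w" "lipschitz_near mom_Y w"
    unfolding mom_X_def mom_Y_def by (intro diff lipschitz_near_add lipschitz_near_mult lipschitz_near_const coord)+
  note intros = diff neg lipschitz_near_add lipschitz_near_mult lipschitz_near_const coord rsq inv XY
  have q: "lipschitz_near (\<lambda>w. fst (kh_field w) $ 1) w" "lipschitz_near (\<lambda>w. fst (kh_field w) $ 2) w"
    "lipschitz_near (\<lambda>w. fst (kh_field w) $ 3) w"
    unfolding kh_field_def fst_conv vector_3 by (intro intros)+
  have p: "lipschitz_near (\<lambda>w. snd (kh_field w) $ 1) w" "lipschitz_near (\<lambda>w. snd (kh_field w) $ 2) w"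
    "lipschitz_near (\<lambda>w. snd (kh_field w) $ 3) w"
    unfolding kh_field_def snd_conv vector_3 divide_inverse by (intro intros)+
  have embed: "lipschitz_near (\<lambda>w. f w *\<^sub>R e) w" if "lipschitz_near f w" for f :: "phase \<Rightarrow> real" and e :: phase
    by (rule lipschitz_near_compose[OF that, of "\<lambda>r. r *\<^sub>R e"])
      (rule lipschitz_near_linear[OF bounded_linear_scaleR_left])
  have "kh_field = (\<lambda>w. fst (kh_field w) $ 1 *\<^sub>R (axis 1 1, 0) + (fst (kh_field w) $ 2 *\<^sub>R (axis 2 1, 0) +
      (fst (kh_field w) $ 3 *\<^sub>R (axis 3 1, 0) + (snd (kh_field w) $ 1 *\<^sub>R (0, axis 1 1) +
      (snd (kh_field w) $ 2 *\<^sub>R (0, axis 2 1) + snd (kh_field w) $ 3 *\<^sub>R (0, axis 3 1))))))"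
    by (rule ext, subst phase_eq_iff) (simp add: axis_def)
  moreover have "lipschitz_near (\<lambda>w. fst (kh_field w) $ 1 *\<^sub>R (axis 1 1, 0) + (fst (kh_field w) $ 2 *\<^sub>R (axis 2 1, 0) +
      (fst (kh_field w) $ 3 *\<^sub>R (axis 3 1, 0) + (snd (kh_field w) $ 1 *\<^sub>R (0, axis 1 1) +
      (snd (kh_field w) $ 2 *\<^sub>R (0, axis 2 1) + snd (kh_field w) $ 3 *\<^sub>R (0, axis 3 1))))) :: phase) w"
    by (intro lipschitz_near_add embed q p)
  ultimately show ?thesis by (rule ssubst[where P="\<lambda>f. lipschitz_near f w"])
qed

lemma hamilton_solutionD:
  assumes "hamilton_solution I c"
  shows "open I" "is_interval I" "I \<noteq> {}" "t \<in> I \<Longrightarrow> fst (c t) \<noteq> 0"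
    "t \<in> I \<Longrightarrow> (c has_vector_derivative kh_field (c t)) (at t)"
  using assms by (simp_all add: hamilton_solution_iff)

lemma hamilton_solutionI:
  assumes "open I" "is_interval I" "I \<noteq> {}" "\<And>t. t \<in> I \<Longrightarrow> fst (c t) \<noteq> 0"
    "\<And>t. t \<in> I \<Longrightarrow> (c has_vector_derivative kh_field (c t)) (at t)"
  shows "hamilton_solution I c"
  using assms by (simp add: hamilton_solution_iff)

lemma hamilton_solutions_agree:
  assumes c: "hamilton_solution I c" and c': "hamilton_solution I' c'"
    and "a \<in> I \<inter> I'" "c a = c' a" "t \<in> I \<inter> I'"
  shows "c t = c' t"
proof (rule ode_solutions_agree[of "I \<inter> I'" a c c' kh_field])
  show "open (I \<inter> I')" "is_interval (I \<inter> I')"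
    using c c' by (auto simp: hamilton_solution_iff is_interval_Int)
  show "(c has_vector_derivative kh_field (c t)) (at t)" "(c' has_vector_derivative kh_field (c' t)) (at t)"
    "lipschitz_near kh_field (c t)" if "t \<in> I \<inter> I'" for t
    using that hamilton_solutionD(4,5)[OF c, of t] hamilton_solutionD(5)[OF c', of t] kh_field_lipschitz_near[of "c t"]
    by simp_all
qed (fact assms)+

text \<open>Two solutions that agree once agree on the whole overlap of their intervals, so together they form a
  solution on the union; maximality forbids this union to be larger.\<close>

lemma maximal_hamilton_solution_absorbs:
  assumes max: "maximal_hamilton_solution I c" and c': "hamilton_solution I' c'"
    and a: "a \<in> I \<inter> I'" "c a = c' a" and t: "t \<in> I'"
  shows "t \<in> I \<and> c t = c' t"
proof -
  have c: "hamilton_solution I c" using max by (simp add: maximal_hamilton_solution_def)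
  define d where "d t = (if t \<in> I then c t else c' t)" for t
  have d: "d t = c t" if "t \<in> I" for t using that by (simp add: d_def)
  have d': "d t = c' t" if "t \<in> I'" for t
    using that hamilton_solutions_agree[OF c c' a] by (simp add: d_def)
  have deriv: "(d has_vector_derivative kh_field (d t)) (at t)"
    if "hamilton_solution K e" "\<And>u. u \<in> K \<Longrightarrow> d u = e u" "t \<in> K" for K e t
  proof -
    have e: "(e has_vector_derivative kh_field (d t)) (at t)" "open K"
      using hamilton_solutionD(1)[OF that(1)] hamilton_solutionD(5)[OF that(1), of t] that(2)[OF that(3)] that(3) by simp_all
    show ?thesis
      by (rule has_vector_derivative_transform_within_open[OF e that(3)]) (simp add: that(2))
  qed
  have "is_interval (I \<union> I')"
    using hamilton_solutionD(2)[OF c] hamilton_solutionD(2)[OF c'] a(1) unfolding is_interval_connected_1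
    by (intro connected_Un) blast+
  moreover have "fst (d t) \<noteq> 0" "(d has_vector_derivative kh_field (d t)) (at t)" if "t \<in> I \<union> I'" for t
    using that hamilton_solutionD(4)[OF c, of t] hamilton_solutionD(4)[OF c', of t]
      deriv[OF c d, of t] deriv[OF c' d', of t] d[of t] d'[of t] by auto
  ultimately have "hamilton_solution (I \<union> I') d"
    using hamilton_solutionD(1,3)[OF c] hamilton_solutionD(1)[OF c']
    by (intro hamilton_solutionI) (simp_all add: open_Un)
  then have "I \<union> I' = I"
    using max d unfolding maximal_hamilton_solution_def by (metis Un_upper1)
  then have "t \<in> I" using t by blast
  then show ?thesis using hamilton_solutions_agree[OF c c' a] t by blast
qed

text \<open>The symmetries of the problem that multiply lengths: such a map carries solutions to solutions
  when time is rescaled by the square of the factor.\<close>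

definition similarity :: "real \<Rightarrow> real \<Rightarrow> phase \<Rightarrow> phase" where
  "similarity \<phi> \<mu> w = rotation \<phi> (dilation \<mu> w)"

lemma similarity_coords [simp]:
  "x_of (similarity \<phi> \<mu> w) = \<mu> * (cos \<phi> * x_of w - sin \<phi> * y_of w)"
  "y_of (similarity \<phi> \<mu> w) = \<mu> * (sin \<phi> * x_of w + cos \<phi> * y_of w)"
  "z_of (similarity \<phi> \<mu> w) = \<mu>\<^sup>2 * z_of w"
  "px_of (similarity \<phi> \<mu> w) = (cos \<phi> * px_of w - sin \<phi> * py_of w) / \<mu>"
  "py_of (similarity \<phi> \<mu> w) = (sin \<phi> * px_of w + cos \<phi> * py_of w) / \<mu>"
  "pz_of (similarity \<phi> \<mu> w) = pz_of w / \<mu>\<^sup>2"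
  by (simp_all add: similarity_def rotation_def dilation_def algebra_simps diff_divide_distrib add_divide_distrib)

lemma bounded_linear_similarity: "bounded_linear (similarity \<phi> \<mu>)"
  unfolding linear_conv_bounded_linear[symmetric]
  by (rule linearI; subst phase_eq_iff) (simp_all add: algebra_simps add_divide_distrib diff_divide_distrib)

lemma rsq_similarity [simp]: "rsq (similarity \<phi> \<mu> w) = \<mu>\<^sup>2 * rsq w"
proof -
  have "rsq (similarity \<phi> \<mu> w) = \<mu>\<^sup>2 * (((cos \<phi>)\<^sup>2 + (sin \<phi>)\<^sup>2) * rsq w)"
    unfolding rsq_def similarity_coords by algebra
  then show ?thesis by simp
qed

lemma gauge4_similarity [simp]: "gauge4 (similarity \<phi> \<mu> w) = \<mu> ^ 4 * gauge4 w"
  by (simp add: gauge4_def algebra_simps power_mult_distrib flip: power_mult)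

lemma fst_similarity_nonzero:
  assumes "0 < \<mu>" "fst w \<noteq> 0"
  shows "fst (similarity \<phi> \<mu> w) \<noteq> 0"
proof
  assume "fst (similarity \<phi> \<mu> w) = 0"
  then have "gauge4 (similarity \<phi> \<mu> w) = 0" by (simp add: gauge4_def rsq_def)
  then show False using assms gauge4_pos[of w] by simp
qed

lemma kh_field_similarity:
  assumes "0 < \<mu>"
  shows "kh_field (similarity \<phi> \<mu> w) = (1 / \<mu>\<^sup>2) *\<^sub>R similarity \<phi> \<mu> (kh_field w)"
proof -
  let ?c = "cos \<phi>" and ?s = "sin \<phi>" and ?v = "similarity \<phi> \<mu> w"
  have mom: "mom_X ?v = (?c * mom_X w - ?s * mom_Y w) / \<mu>" "mom_Y ?v = (?s * mom_X w + ?c * mom_Y w) / \<mu>"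
    using assms by (simp_all add: mom_X_def mom_Y_def field_simps power2_eq_square)
  have "sqrt (gauge4 ?v) = sqrt ((\<mu>\<^sup>2)\<^sup>2 * gauge4 w)" by (simp flip: power_mult)
  also have "\<dots> = \<mu>\<^sup>2 * sqrt (gauge4 w)" by (simp only: real_sqrt_mult real_sqrt_abs abs_power2)
  finally have sq: "sqrt (gauge4 ?v) = \<mu>\<^sup>2 * sqrt (gauge4 w)" .
  have cs: "?c * ?c + ?s * ?s = 1" using sin_cos_squared_add3[of \<phi>] by simp
  define k where "k = gauge4 w * sqrt (gauge4 w)"
  have k: "gauge4 ?v * sqrt (gauge4 ?v) = \<mu> ^ 6 * k"
    unfolding sq by (simp add: k_def power2_eq_square power4_eq_xxxx eval_nat_numeral)
  have z: "x_of ?v * mom_Y ?v - y_of ?v * mom_X ?v = x_of w * mom_Y w - y_of w * mom_X w"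
  proof -
    have "x_of ?v * mom_Y ?v - y_of ?v * mom_X ?v
        = (?c * x_of w - ?s * y_of w) * (?s * mom_X w + ?c * mom_Y w)
          - (?s * x_of w + ?c * y_of w) * (?c * mom_X w - ?s * mom_Y w)"
      using assms unfolding mom by simp
    also have "\<dots> = (?c * ?c + ?s * ?s) * (x_of w * mom_Y w - y_of w * mom_X w)"
      by algebra
    finally show ?thesis by (simp only: cs mult_1)
  qed
  \<comment> \<open>All terms of a component scale alike; the cancellations are prepared by hand since they involve
    a quotient by the opaque quantity k, which may be 0 here.\<close>
  have mu6: "\<mu> ^ 6 = \<mu> ^ 3 * \<mu> ^ 3" "\<mu> ^ 6 = \<mu>\<^sup>2 * (\<mu>\<^sup>2 * \<mu>\<^sup>2)" by (simp_all flip: power_add)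
  have cancel: "X * m / (m * m * k) = X / k / m" if "m \<noteq> 0" for X m :: real
    using that by (simp add: mult.commute)
  have cancel2: "- (e * (m * b) / (m * (m * m) * k)) = 1 / m * (- (e * b / k) / m)" if "m \<noteq> 0" for e m b :: real
    using that by simp
  define F where "F = coupling * rsq w / k"
  have force: "coupling * (\<mu> * a) * (\<mu>\<^sup>2 * rsq w) / (\<mu> ^ 6 * k) = F * a / \<mu> ^ 3"
    "coupling * a * rsq w / k = F * a" for a
  proof -
    have "coupling * (\<mu> * a) * (\<mu>\<^sup>2 * rsq w) = coupling * rsq w * a * \<mu> ^ 3"
      by (simp only: power2_eq_square power3_eq_cube mult.assoc mult.left_commute mult.commute)
    moreover have "coupling * rsq w * a / k / \<mu> ^ 3 = F * a / \<mu> ^ 3" by (simp add: F_def)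
    ultimately show "coupling * (\<mu> * a) * (\<mu>\<^sup>2 * rsq w) / (\<mu> ^ 6 * k) = F * a / \<mu> ^ 3"
      unfolding mu6(1) using cancel[of "\<mu> ^ 3" "coupling * rsq w * a"] assms by (simp only:) simp
  qed (simp add: F_def)
  have rot: "e * (p / \<mu>\<^sup>2) * (a / \<mu>) - b / \<mu> ^ 3 = 1 / \<mu>\<^sup>2 * ((e * p * a - b) / \<mu>)" for e p a b :: real
    by (simp add: divide_inverse algebra_simps power2_eq_square power3_eq_cube)
  have "- (1/2 * (pz_of w / \<mu>\<^sup>2) * ((?s * mom_X w + ?c * mom_Y w) / \<mu>)) - F * (?c * x_of w - ?s * y_of w) / \<mu> ^ 3
      = 1 / \<mu>\<^sup>2 * ((?c * (- (1/2 * pz_of w * mom_Y w) - F * x_of w)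
          - ?s * (1/2 * pz_of w * mom_X w - F * y_of w)) / \<mu>)"
    using rot[of "- (1/2)" "pz_of w" "?s * mom_X w + ?c * mom_Y w" "F * (?c * x_of w - ?s * y_of w)"]
    by (simp add: algebra_simps)
  moreover have "1/2 * (pz_of w / \<mu>\<^sup>2) * ((?c * mom_X w - ?s * mom_Y w) / \<mu>) - F * (?s * x_of w + ?c * y_of w) / \<mu> ^ 3
      = 1 / \<mu>\<^sup>2 * ((?s * (- (1/2 * pz_of w * mom_Y w) - F * x_of w)
          + ?c * (1/2 * pz_of w * mom_X w - F * y_of w)) / \<mu>)"
    using rot[of "1/2" "pz_of w" "?c * mom_X w - ?s * mom_Y w" "F * (?s * x_of w + ?c * y_of w)"]
    by (simp add: algebra_simps)
  moreover have "- (8 * coupling * (\<mu>\<^sup>2 * z_of w) / (\<mu> ^ 6 * k)) = 1 / \<mu>\<^sup>2 * (- (8 * coupling * z_of w / k) / \<mu>\<^sup>2)"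
    unfolding mu6(2) using assms by (intro cancel2) simp
  moreover have "1 / \<mu>\<^sup>2 * (\<mu> * a) = a / \<mu>" "1 / \<mu>\<^sup>2 * (\<mu>\<^sup>2 * b) = b" for a b
    using assms by (simp_all add: power2_eq_square)
  ultimately show ?thesis
    unfolding phase_eq_iff
    by (simp only: kh_field_def k k_def[symmetric] z[unfolded mom similarity_coords] mom similarity_coords rsq_similarity force
        fst_conv snd_conv vector_3 fst_scaleR snd_scaleR vector_scaleR_component real_scaleR_def simp_thms)
qed

lemma hamilton_solution_similarity:
  assumes c: "hamilton_solution I c" and "0 < \<mu>"
  shows "hamilton_solution ((\<lambda>t. b + \<mu>\<^sup>2 * (t - a)) ` I) (\<lambda>t. similarity \<phi> \<mu> (c (a + (t - b) / \<mu>\<^sup>2)))"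
    (is "hamilton_solution (?f ` I) ?d")
proof -
  have f: "?f = (\<lambda>t. (b - \<mu>\<^sup>2 * a) + \<mu>\<^sup>2 *\<^sub>R t)" by (auto simp: algebra_simps)
  have "open (?f ` I)"
    using hamilton_solutionD(1)[OF c] assms(2) unfolding f by (intro open_affinity) auto
  moreover have "is_interval (?f ` I)"
    using hamilton_solutionD(2)[OF c] unfolding is_interval_connected_1
    by (intro connected_continuous_image continuous_intros) auto
  moreover have "fst (?d t) \<noteq> 0 \<and> (?d has_vector_derivative kh_field (?d t)) (at t)" if "t \<in> ?f ` I" for t
  proof -
    let ?g = "\<lambda>t. a + (t - b) / \<mu>\<^sup>2"
    have g: "?g t \<in> I" using that assms(2) by auto
    have "(?g has_vector_derivative 1 / \<mu>\<^sup>2) (at t)"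
      unfolding has_real_derivative_iff_has_vector_derivative[symmetric]
      using assms(2) by (auto intro!: derivative_eq_intros simp: divide_simps power2_eq_square power4_eq_xxxx)
    moreover have "(c has_vector_derivative kh_field (c (?g t))) (at (?g t))"
      by (rule hamilton_solutionD(5)[OF c g])
    ultimately have "((\<lambda>t. c (?g t)) has_vector_derivative (1 / \<mu>\<^sup>2) *\<^sub>R kh_field (c (?g t))) (at t)"
      using vector_diff_chain_at[of ?g _ t c] by (simp add: o_def)
    then have "(?d has_vector_derivative similarity \<phi> \<mu> ((1 / \<mu>\<^sup>2) *\<^sub>R kh_field (c (?g t)))) (at t)"
      by (rule bounded_linear.has_vector_derivative[OF bounded_linear_similarity])
    then show ?thesis
      using fst_similarity_nonzero[OF assms(2) hamilton_solutionD(4)[OF c g], of \<phi>]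
      by (simp add: kh_field_similarity[OF assms(2)] linear_scale[OF bounded_linear.linear[OF bounded_linear_similarity]])
  qed
  ultimately show ?thesis
    using hamilton_solutionD(3)[OF c] by (intro hamilton_solutionI) auto
qed

text \<open>If the state at time b is a similar copy of the state at time a, then rescaling time about these two
  instants turns the orbit into a solution through its own state at b. The maximal solution absorbs it, so
  its interval contains the rescaled one and the whole motion repeats itself up to the similarity.\<close>

proposition self_similar_motion:
  assumes max: "maximal_hamilton_solution I c" and "0 < \<mu>" "a \<in> I" "b \<in> I"
    and return: "c b = similarity \<phi> \<mu> (c a)" and "t \<in> I"
  shows "b + \<mu>\<^sup>2 * (t - a) \<in> I \<and> c (b + \<mu>\<^sup>2 * (t - a)) = similarity \<phi> \<mu> (c t)"
proof -
  let ?f = "\<lambda>t. b + \<mu>\<^sup>2 * (t - a)"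
  have "hamilton_solution (?f ` I) (\<lambda>t. similarity \<phi> \<mu> (c (a + (t - b) / \<mu>\<^sup>2)))"
    using max \<open>0 < \<mu>\<close> by (intro hamilton_solution_similarity) (auto simp: maximal_hamilton_solution_def)
  note absorbs = maximal_hamilton_solution_absorbs[OF max this, of b "?f t"]
  have "b \<in> ?f ` I" "?f t \<in> ?f ` I" using assms by (auto intro!: image_eqI[of b ?f a])
  with absorbs show ?thesis using assms by simp
qed

section \<open>A comparison weight for the reduced motion\<close>

text \<open>With \<open>u = 4 z / (x\<^sup>2 + y\<^sup>2)\<close> this is the ratio of the homogeneous norm to the distance from the
  z-axis.\<close>

definition brk :: "real \<Rightarrow> real" where
  "brk u = sqrt (sqrt (1 + u\<^sup>2))"

text \<open>A zero-energy motion with dilational momentum J and angular momentum P (both in units of the square root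
  of the coupling constant) is described up to similarity by u and a point \<open>(profile J P u, c)\<close> on the unit circle.
  The growth rate of \<open>s\<close> is a positive multiple of \<open>profile\<close>, and c decreases at \<open>turning\<close> times the
  growth rate of \<open>s\<close>.\<close>

definition profile :: "real \<Rightarrow> real \<Rightarrow> real \<Rightarrow> real" where
  "profile J P u = (J + P * u) / brk u"

definition turning :: "real \<Rightarrow> real \<Rightarrow> real \<Rightarrow> real" where
  "turning J P u = (P * (2 + u\<^sup>2) - J * u) / brk u"

lemma brk_pos [simp]: "0 < brk u"
  by (simp add: brk_def add_pos_nonneg)

lemma brk_nonzero [simp]: "brk u \<noteq> 0"
  using brk_pos[of u] by linarith

lemma brk_not_neg [simp]: "\<not> brk u < 0"
  using brk_pos[of u] by linarith

lemma brk_0 [simp]: "brk 0 = 1"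
  by (simp add: brk_def)

lemma brk_minus [simp]: "brk (- u) = brk u"
  by (simp add: brk_def)

lemma brk_pow4: "brk u ^ 4 = 1 + u\<^sup>2"
proof -
  have "brk u ^ 4 = ((brk u)\<^sup>2)\<^sup>2" by (simp flip: power_mult)
  also have "\<dots> = 1 + u\<^sup>2" by (simp add: brk_def)
  finally show ?thesis .
qed

lemma brk_ge_1: "1 \<le> brk u"
  by (simp add: brk_def)

lemma brk_mono: "0 \<le> x \<Longrightarrow> x \<le> y \<Longrightarrow> brk x \<le> brk y"
  by (simp add: brk_def power_mono)

text \<open>Compare fourth powers: \<open>x\<^sup>4 (1 + y\<^sup>2) < y\<^sup>4 (1 + x\<^sup>2)\<close>.\<close>

lemma over_brk_strict_mono:
  assumes "0 \<le> x" "x < y"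
  shows "x / brk x < y / brk y"
proof -
  have "x ^ 4 < y ^ 4"
    using assms by (intro power_strict_mono) auto
  moreover have "x\<^sup>2 * (x * y)\<^sup>2 \<le> y\<^sup>2 * (x * y)\<^sup>2"
    using assms by (intro mult_right_mono power_mono) auto
  ultimately have "x ^ 4 * (1 + y\<^sup>2) < y ^ 4 * (1 + x\<^sup>2)"
    by (simp add: algebra_simps power2_eq_square power4_eq_xxxx)
  then have "(x * brk y) ^ 4 < (y * brk x) ^ 4"
    by (simp add: power_mult_distrib brk_pow4)
  then have "x * brk y < y * brk x"
    using assms by (elim power_less_imp_less_base) (auto simp: less_imp_le)
  then show ?thesis by (simp add: divide_simps mult.commute)
qed

text \<open>In terms of \<open>b = brk x\<close> the quotient is \<open>b\<^sup>3 + 1 / b\<close>, which increases for \<open>b \<ge> 1\<close>.\<close>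

lemma quadratic_over_brk_mono:
  assumes "0 \<le> x" "x \<le> y"
  shows "(2 + x\<^sup>2) / brk x \<le> (2 + y\<^sup>2) / brk y"
proof -
  let ?b = "brk x" and ?c = "brk y"
  have bc: "1 \<le> ?b" "?b \<le> ?c" using brk_ge_1 brk_mono[OF assms] by auto
  have eq: "(2 + u\<^sup>2) / brk u = brk u ^ 3 + 1 / brk u" for u
  proof -
    have "2 + u\<^sup>2 = brk u ^ 4 + 1" by (simp add: brk_pow4)
    then show ?thesis by (simp add: field_simps power4_eq_xxxx power3_eq_cube)
  qed
  have "1 / ?b - 1 / ?c = (?c - ?b) / (?b * ?c)"
    using bc by (simp add: field_simps)
  also have "\<dots> \<le> (?c - ?b) / 1"
    using bc mult_mono[of 1 ?b 1 ?c] by (intro divide_left_mono) auto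
  also have "\<dots> \<le> (?c - ?b) * (?c\<^sup>2 + ?b * ?c + ?b\<^sup>2)"
  proof -
    have "1 \<le> ?b\<^sup>2" using bc by simp
    moreover have "0 \<le> ?c\<^sup>2 + ?b * ?c" using bc by simp
    ultimately have "1 \<le> ?c\<^sup>2 + ?b * ?c + ?b\<^sup>2" by linarith
    then have "(?c - ?b) * 1 \<le> (?c - ?b) * (?c\<^sup>2 + ?b * ?c + ?b\<^sup>2)"
      using bc by (intro mult_left_mono) auto
    then show ?thesis by simp
  qed
  also have "\<dots> = ?c ^ 3 - ?b ^ 3"
    by (simp add: algebra_simps power2_eq_square power3_eq_cube)
  finally show ?thesis unfolding eq by linarith
qed

lemma profile_reflect_strict_mono:
  assumes "0 \<le> J" "0 < P" "0 \<le> x" "x < y"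
  shows "(P * x - J) / brk x < (P * y - J) / brk y"
proof -
  have "P * (x / brk x) < P * (y / brk y)"
    using over_brk_strict_mono assms by (intro mult_strict_left_mono)
  moreover have "J / brk y \<le> J / brk x"
    using brk_mono[of x y] assms by (intro divide_left_mono) auto
  ultimately show ?thesis by (simp add: diff_divide_distrib)
qed

lemma turning_reflect_mono:
  assumes "0 \<le> J" "0 < P" "0 \<le> x" "x \<le> y"
  shows "turning J P (- x) \<le> turning J P (- y)"
proof -
  have "x / brk x \<le> y / brk y"
    using over_brk_strict_mono[of x y] assms by (cases "x = y") auto
  then have "P * ((2 + x\<^sup>2) / brk x) + J * (x / brk x) \<le> P * ((2 + y\<^sup>2) / brk y) + J * (y / brk y)"
    using quadratic_over_brk_mono[of x y] assms by (intro add_mono mult_left_mono) auto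
  moreover have "turning J P (- u) = P * ((2 + u\<^sup>2) / brk u) + J * (u / brk u)" for u
    by (simp add: turning_def add_divide_distrib[symmetric])
  ultimately show ?thesis by simp
qed

text \<open>If \<open>\<kappa>\<close> is the derivative of a function \<open>\<Omega>\<close>, then the growth rate of \<open>s + \<Omega> c\<close> along the motion is
  a positive multiple of the number E below. A comparison weight thus produces a quantity that differs from
  \<open>s\<close> by a function of the reduced state only and that is monotone in the direction given by the sign of J,
  constant for \<open>J = 0\<close>, and strictly monotone where \<open>z = 0\<close> otherwise.\<close>

definition comparison_weight :: "real \<Rightarrow> real \<Rightarrow> (real \<Rightarrow> real) \<Rightarrow> bool" where
  "comparison_weight J P \<kappa> \<longleftrightarrow> continuous_on UNIV \<kappa> \<and>
     (\<forall>u c. (profile J P u)\<^sup>2 + c\<^sup>2 = 1 \<longrightarrow>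
        (let E = profile J P u * (1 - \<kappa> c * turning J P u)
         in 0 \<le> J * E \<and> (J = 0 \<longrightarrow> E = 0) \<and> (u = 0 \<and> J \<noteq> 0 \<longrightarrow> 0 < J * E)))"

text \<open>Reversal of time changes the signs of both momenta.\<close>

lemma comparison_weight_reverse:
  assumes "comparison_weight J P \<kappa>"
  shows "comparison_weight (- J) (- P) (\<lambda>c. - \<kappa> c)"
proof -
  have [simp]: "profile (- J) (- P) u = - profile J P u" "turning (- J) (- P) u = - turning J P u" for u
    by (simp_all add: profile_def turning_def field_simps)
  show ?thesis
    using assms unfolding comparison_weight_def
    by (auto simp: Let_def intro: continuous_intros)
qed

text \<open>The reflection in a line of the horizontal plane, which also changes the sign of z, changes the sign
  of the angular momentum alone.\<close>

lemma comparison_weight_reflect: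
  assumes "comparison_weight J P \<kappa>"
  shows "comparison_weight J (- P) (\<lambda>c. - \<kappa> c)"
proof -
  have [simp]: "profile J (- P) u = profile J P (- u)" "turning J (- P) u = - turning J P (- u)" for u
    by (simp_all add: profile_def turning_def field_simps)
  show ?thesis
    using assms unfolding comparison_weight_def
    by (auto simp: Let_def intro: continuous_intros) 
qed

lemma comparison_weight_axial: "comparison_weight J 0 (\<lambda>c. 0)"
proof -
  have "J * profile J 0 u = J\<^sup>2 / brk u" for u
    by (simp add: profile_def power2_eq_square)
  then show ?thesis
    by (auto simp: comparison_weight_def Let_def less_imp_le profile_def)
qed

text \<open>For \<open>J \<ge> 0\<close> and \<open>P > 0\<close> the profile is negative exactly for \<open>u < - J / P\<close>, and there it is strictly
  increasing, so that \<open>u\<close> is a function \<open>- x c\<close> of \<open>c\<close>. The choice \<open>\<kappa> = 1 / turning\<close> at this point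
  cancels every loss. At a point u where the profile is positive, the point \<open>- x c\<close> with the opposite value of the profile is at least as
  far from 0 as u: this is clear for \<open>u \<le> 0\<close>, and otherwise it holds because
  \<open>profile (- u) \<ge> - profile u\<close>. As \<open>turning\<close> grows with the distance from 0 on the negative side and is not larger
  at u than at its mirror image there, \<open>\<kappa> c * turning J P u \<le> 1\<close> and nothing is lost. For \<open>J = 0\<close> the two
  points are mirror images and everything cancels.\<close>

lemma comparison_weight_pos:
  assumes "0 \<le> J" "0 < P"
  shows "\<exists>\<kappa>. comparison_weight J P \<kappa>"
proof -
  define H where "H x = (P * x - J) / brk x" for x
  have H_mono: "H x < H y" if "0 \<le> x" "x < y" for x y
    unfolding H_def using profile_reflect_strict_mono assms that by blast
  have JP: "0 \<le> J / P" "H (J / P) = 0" using assms by (auto simp: H_def)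
  have H_cont: "continuous_on A H" for A
    unfolding H_def brk_def
    by (intro continuous_intros) (auto simp: add_pos_nonneg less_imp_neq[OF brk_pos, symmetric] simp flip: brk_def)
  have H_onto: "\<exists>x\<ge>J / P. H x = \<eta>" if "0 \<le> \<eta>" for \<eta>
  proof -
    \<comment> \<open>With \<open>1 + y = m\<^sup>2\<close> one has \<open>brk y \<le> m\<close>, and m is so large that \<open>P y - J \<ge> \<eta> m\<close>.\<close>
    define m where "m = 1 + (\<eta> + P + J) / P"
    define y where "y = m\<^sup>2 - 1"
    have m: "1 \<le> m" "P * m = \<eta> + P + J + P"
      using assms that by (auto simp: m_def field_simps)
    have y: "0 \<le> y" using m by (simp add: y_def)
    have "1 + y\<^sup>2 \<le> (1 + y)\<^sup>2"
      using y by (simp add: power2_sum)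
    then have "brk y \<le> sqrt (sqrt ((1 + y)\<^sup>2))"
      by (simp only: brk_def real_sqrt_le_iff)
    also have "\<dots> = sqrt (1 + y)" using y by simp
    also have "\<dots> = m" using m by (simp add: y_def)
    finally have "brk y \<le> m" .
    then have "\<eta> * brk y \<le> \<eta> * m" using that by (rule mult_left_mono)
    also have "\<dots> \<le> P * y - J"
    proof -
      have "P * y = (\<eta> + P + J + P) * m - P"
        unfolding m(2)[symmetric] by (simp add: y_def algebra_simps power2_eq_square)
      moreover have "(P + J) * 1 \<le> (P + J) * m"
        using assms m by (intro mult_left_mono) auto
      moreover have "0 \<le> P * m" using assms(2) m(1) by (intro mult_nonneg_nonneg) auto
      ultimately show ?thesis by (simp add: algebra_simps)
    qed
    finally have "\<eta> \<le> H y" by (simp add: H_def field_simps)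
    moreover have "J / P \<le> y"
    proof (rule ccontr)
      assume "\<not> J / P \<le> y"
      then have "H y < H (J / P)" using y by (intro H_mono) auto
      then show False using \<open>\<eta> \<le> H y\<close> that JP by simp
    qed
    ultimately show ?thesis
      using IVT'[of H "J / P" \<eta> y] H_cont that JP by auto
  qed
  define g where "g = inv_into {J / P..} H"
  have H_inj: "inj_on H {J / P..}"
  proof (rule linorder_inj_onI)
    fix x y assume "x < y" "x \<in> {J / P..}"
    then show "H x \<noteq> H y" using H_mono[of x y] JP by auto
  qed auto
  have H_range: "H ` {J / P..} = {0..}"
  proof (intro equalityI subsetI)
    fix \<eta> assume "\<eta> \<in> H ` {J / P..}"
    then obtain x where "J / P \<le> x" "\<eta> = H x" by auto
    then show "\<eta> \<in> {0..}" using H_mono[of "J / P" x] JP by (cases "x = J / P") auto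
  qed (use H_onto in force)
  have gH: "g (H x) = x" if "J / P \<le> x" for x
    unfolding g_def using H_inj that by (intro inv_into_f_f) auto
  have Hg: "H (g \<eta>) = \<eta>" "J / P \<le> g \<eta>" if "0 \<le> \<eta>" for \<eta>
    using that f_inv_into_f[of \<eta> H "{J / P..}"] inv_into_into[of \<eta> H "{J / P..}"]
    unfolding H_range g_def by auto
  have g_cont: "continuous_on {0..1} g"
  proof -
    obtain y where y: "J / P \<le> y" "H y = 1" using H_onto[of 1] by auto
    have "{0..1} \<subseteq> H ` {J / P..y}"
    proof
      fix \<eta> :: real assume "\<eta> \<in> {0..1}"
      then show "\<eta> \<in> H ` {J / P..y}"
        using IVT'[of H "J / P" \<eta> y] H_cont JP y by auto
    qed
    moreover have "continuous_on (H ` {J / P..y}) g"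
      by (rule continuous_on_inv[OF H_cont]) (auto intro: gH)
    ultimately show ?thesis by (rule continuous_on_subset[rotated])
  qed

  \<comment> \<open>The maximum only makes x total and continuous; on the unit circle \<open>c\<^sup>2 \<le> 1\<close>.\<close>
  define x where "x c = g (sqrt (max 0 (1 - c\<^sup>2)))" for c
  have x_ge: "J / P \<le> x c" "0 \<le> x c" for c
    unfolding x_def using Hg(2)[of "sqrt (max 0 (1 - c\<^sup>2))"] JP by auto
  have x_cont: "continuous_on UNIV x"
    unfolding x_def by (rule continuous_on_compose2[OF g_cont]) (auto intro!: continuous_intros)
  have turning_pos: "0 < turning J P (- x c)" for c
  proof -
    have "0 < P * (2 + (x c)\<^sup>2)" using assms by (intro mult_pos_pos) (auto simp: add_pos_nonneg)
    moreover have "0 \<le> J * x c" using assms x_ge by simp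
    ultimately show ?thesis by (simp add: turning_def)
  qed
  define \<kappa> where "\<kappa> c = 1 / turning J P (- x c)" for c
  have "continuous_on UNIV \<kappa>"
    unfolding \<kappa>_def
  proof (intro continuous_intros ballI)
    show "continuous_on UNIV (\<lambda>c. turning J P (- x c))"
      unfolding turning_def brk_def
      by (intro continuous_intros x_cont ballI)
        (simp only: brk_def[symmetric] brk_nonzero not_False_eq_True)
    show "turning J P (- x c) \<noteq> 0" for c using turning_pos[of c] by simp
  qed
  moreover have "let E = profile J P u * (1 - \<kappa> c * turning J P u)
         in 0 \<le> J * E \<and> (J = 0 \<longrightarrow> E = 0) \<and> (u = 0 \<and> J \<noteq> 0 \<longrightarrow> 0 < J * E)"
    if level: "(profile J P u)\<^sup>2 + c\<^sup>2 = 1" for u c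
  proof -
    have "c\<^sup>2 \<le> 1"
      using level zero_le_power2[of "profile J P u"] by linarith
    then have "max 0 (1 - c\<^sup>2) = (profile J P u)\<^sup>2"
      using level by (simp add: max_def)
    then have eta: "sqrt (max 0 (1 - c\<^sup>2)) = \<bar>profile J P u\<bar>" by simp
    then have Hx: "H (x c) = \<bar>profile J P u\<bar>"
      using Hg(1)[of "\<bar>profile J P u\<bar>"] by (simp add: x_def)
    consider (zero) "profile J P u = 0" | (neg) "profile J P u < 0" | (pos) "0 < profile J P u" by linarith
    then show ?thesis
    proof cases
      case zero
      then show ?thesis using assms by (auto simp: Let_def profile_def)
    next
      case neg
      then have "J + P * u < 0" by (simp add: profile_def divide_less_0_iff)
      then have "u < - (J / P)" using assms by (simp add: field_simps)
      moreover have "H (- u) = - profile J P u"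
        by (simp add: H_def profile_def field_simps)
      then have "H (- u) = \<bar>profile J P u\<bar>" using neg by simp
      ultimately have "x c = - u"
        unfolding x_def eta using gH[of "- u"] by simp
      then have "1 - \<kappa> c * turning J P u = 0"
        using turning_pos[of c] by (simp add: \<kappa>_def)
      moreover have "u \<noteq> 0" using \<open>u < - (J / P)\<close> JP by simp
      ultimately show ?thesis by (simp add: Let_def)
    next
      case pos
      then have JPu: "0 < J + P * u" by (simp add: profile_def zero_less_divide_iff)
      then have u_gt: "- (J / P) < u" using assms by (simp add: field_simps)
      have "\<bar>u\<bar> \<le> x c"
      proof (cases "u \<le> 0")
        case True
        then show ?thesis using u_gt x_ge[of c] by linarith
      next
        case False
        show ?thesis
        proof (rule ccontr)
          assume "\<not> \<bar>u\<bar> \<le> x c"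
          then have "H (x c) < H u" using False x_ge by (intro H_mono) auto
          also have "\<dots> \<le> profile J P u"
            unfolding H_def profile_def using assms by (intro divide_right_mono) (auto simp: less_imp_le)
          finally show False using Hx by simp
        qed
      qed
      then have "turning J P (- \<bar>u\<bar>) \<le> turning J P (- x c)"
        using assms by (intro turning_reflect_mono) auto
      moreover have "turning J P u \<le> turning J P (- \<bar>u\<bar>)"
        using assms brk_pos[of u, THEN less_imp_le] by (auto simp: turning_def abs_if intro!: divide_right_mono)
      ultimately have "1 - \<kappa> c * turning J P u \<ge> 0"
        using turning_pos[of c] by (simp add: \<kappa>_def field_simps)
      then have "0 \<le> J * (profile J P u * (1 - \<kappa> c * turning J P u))"
        using assms pos by (intro mult_nonneg_nonneg) auto
      moreover have "1 - \<kappa> c * turning J P u = 0" if "J = 0"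
      proof -
        have "0 < u" using JPu that assms by (simp add: zero_less_mult_iff)
        then have "H u = H (x c)" unfolding Hx abs_of_pos[OF pos] using that by (simp add: H_def profile_def)
        then have "x c = u" using gH x_ge[of c] \<open>0 < u\<close> that by (metis div_0 less_imp_le)
        then have "turning J P (- x c) = turning J P u" using that by (simp add: turning_def)
        then show ?thesis using turning_pos[of c] by (simp add: \<kappa>_def)
      qed
      moreover have "0 < J * (profile J P u * (1 - \<kappa> c * turning J P u))" if "u = 0" "J \<noteq> 0"
      proof -
        have J: "0 < J" using that assms by simp
        then have "0 < J / P" using assms by simp
        then have xpos: "0 < x c" using x_ge[of c] by linarith
        have "turning J P 0 = P * ((2 + 0\<^sup>2) / brk 0)" by (simp add: turning_def)
        also have "\<dots> \<le> P * ((2 + (x c)\<^sup>2) / brk (x c))"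
          using assms xpos by (intro mult_left_mono quadratic_over_brk_mono) auto
        also have "\<dots> < P * ((2 + (x c)\<^sup>2) / brk (x c)) + J * x c / brk (x c)"
          using J xpos by simp
        also have "\<dots> = turning J P (- x c)"
          by (simp add: turning_def add_divide_distrib[symmetric])
        finally have "0 < 1 - \<kappa> c * turning J P u"
          using turning_pos[of c] that by (simp add: \<kappa>_def field_simps)
        then show ?thesis using J pos by simp
      qed
      ultimately show ?thesis by (auto simp: Let_def)
    qed
  qed
  ultimately show ?thesis unfolding comparison_weight_def by blast
qed

proposition comparison_weight_exists: "\<exists>\<kappa>. comparison_weight J P \<kappa>"
proof -
  have nonneg: "\<exists>\<kappa>. comparison_weight J P \<kappa>" if "0 \<le> J" for J P
  proof -
    consider "0 < P" | "P = 0" | "0 < - P" by linarith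
    then show ?thesis
    proof cases
      case 3
      then show ?thesis
        using comparison_weight_pos[OF that 3] comparison_weight_reflect[of J "- P"] by auto
    qed (use comparison_weight_pos comparison_weight_axial that in blast)+
  qed
  show ?thesis
  proof (cases "0 \<le> J")
    case False
    then show ?thesis
      using nonneg[of "- J" "- P"] comparison_weight_reverse[of "- J" "- P"] by auto
  qed (rule nonneg)
qed

section \<open>First integrals of zero-energy motions\<close>

definition rad_momentum :: "phase \<Rightarrow> real" where
  "rad_momentum w = x_of w * px_of w + y_of w * py_of w"

definition ang_momentum :: "phase \<Rightarrow> real" where
  "ang_momentum w = x_of w * py_of w - y_of w * px_of w"

definition half_pz :: "phase \<Rightarrow> real" where
  "half_pz w = 1/2 * pz_of w"

text \<open>Twice the velocity of z; together with the radial momentum it is the horizontal velocity in polar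
  coordinates, times the distance from the z-axis.\<close>

definition twist :: "phase \<Rightarrow> real" where
  "twist w = ang_momentum w + rsq w * half_pz w"

lemma hamilton_solution_coords:
  assumes "hamilton_solution I c" "t \<in> I"
  shows "((\<lambda>u. fst (c u) $ i) has_real_derivative fst (kh_field (c t)) $ i) (at t)"
    and "((\<lambda>u. snd (c u) $ i) has_real_derivative snd (kh_field (c t)) $ i) (at t)"
proof -
  from assms have "fst (c t) \<noteq> 0"
    "((\<lambda>u. fst (c u) $ i) has_real_derivative partial_p kh_hamiltonian i (c t)) (at t)"
    "((\<lambda>u. snd (c u) $ i) has_real_derivative - partial_q kh_hamiltonian i (c t)) (at t)"
    by (simp_all add: hamilton_solution_def)
  then show "((\<lambda>u. fst (c u) $ i) has_real_derivative fst (kh_field (c t)) $ i) (at t)"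
    and "((\<lambda>u. snd (c u) $ i) has_real_derivative snd (kh_field (c t)) $ i) (at t)"
    by (simp_all add: partial_kh_hamiltonian)
qed

lemma hamilton_solution_rsq_z_pz:
  assumes "hamilton_solution I c" "t \<in> I"
  shows "((\<lambda>u. rsq (c u)) has_real_derivative 2 * rad_momentum (c t)) (at t)"
    and "((\<lambda>u. z_of (c u)) has_real_derivative 1/2 * twist (c t)) (at t)"
    and "((\<lambda>u. half_pz (c u)) has_real_derivative
           - (4 * coupling * z_of (c t) / (gauge4 (c t) * sqrt (gauge4 (c t))))) (at t)"
proof -
  note d = hamilton_solution_coords[OF assms, of 1] hamilton_solution_coords[OF assms, of 2]
    hamilton_solution_coords[OF assms, of 3]
  show "((\<lambda>u. rsq (c u)) has_real_derivative 2 * rad_momentum (c t)) (at t)"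
    unfolding rsq_def rad_momentum_def
    by (rule DERIV_cong[OF DERIV_add[OF DERIV_power[OF d(1)] DERIV_power[OF d(3)]]])
      (simp add: kh_field_def mom_X_def mom_Y_def algebra_simps)
  show "((\<lambda>u. z_of (c u)) has_real_derivative 1/2 * twist (c t)) (at t)"
    by (rule DERIV_cong[OF d(5)])
      (simp add: kh_field_def mom_X_def mom_Y_def twist_def half_pz_def ang_momentum_def rsq_def field_simps power2_eq_square)
  show "((\<lambda>u. half_pz (c u)) has_real_derivative
           - (4 * coupling * z_of (c t) / (gauge4 (c t) * sqrt (gauge4 (c t))))) (at t)"
    unfolding half_pz_def by (rule DERIV_cong[OF DERIV_cmult[OF d(6)]]) (simp add: kh_field_def)
qed

lemma zero_energy_speed:
  assumes "kh_hamiltonian w = 0"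
  shows "(mom_X w)\<^sup>2 + (mom_Y w)\<^sup>2 = coupling / sqrt (gauge4 w)"
proof -
  have "(mom_X w)\<^sup>2 + (mom_Y w)\<^sup>2 = 2 * (1 / (8 * pi * sqrt (gauge4 w)))"
  proof -
    have "a = 2 * b" if "1/2 * a - b = 0" for a b :: real using that by simp
    then show ?thesis using assms unfolding kh_hamiltonian_alt .
  qed
  then show ?thesis by simp
qed

lemma ang_momentum_stationary:
  assumes "hamilton_solution I c" "t \<in> I"
  shows "((\<lambda>u. ang_momentum (c u)) has_real_derivative 0) (at t)"
proof -
  define k where "k = coupling * rsq (c t) / (gauge4 (c t) * sqrt (gauge4 (c t)))"
  have k: "coupling * q * rsq (c t) / (gauge4 (c t) * sqrt (gauge4 (c t))) = q * k" for q
    by (simp add: k_def)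
  note d = hamilton_solution_coords[OF assms, unfolded kh_field_def fst_conv snd_conv]
  note x = d(1)[of 1, unfolded vector_3] and y = d(1)[of 2, unfolded vector_3]
  note px = d(2)[of 1, unfolded vector_3 k] and py = d(2)[of 2, unfolded vector_3 k]
  show ?thesis
    unfolding ang_momentum_def
    by (rule DERIV_cong[OF DERIV_diff[OF DERIV_mult[OF x py] DERIV_mult[OF y px]]])
      (simp add: mom_X_def mom_Y_def algebra_simps)
qed

lemma dil_momentum_stationary:
  assumes "hamilton_solution I c" "t \<in> I" "kh_hamiltonian (c t) = 0"
  shows "((\<lambda>u. dil_momentum (c u)) has_real_derivative 0) (at t)"
proof -
  let ?w = "c t"
  have N: "0 < gauge4 ?w"
    using assms(1,2) by (intro gauge4_pos) (simp add: hamilton_solution_def)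
  define k where "k = coupling / (gauge4 ?w * sqrt (gauge4 ?w))"
  have k: "coupling * q * rsq ?w / (gauge4 ?w * sqrt (gauge4 ?w)) = q * rsq ?w * k"
    "8 * coupling * q / (gauge4 ?w * sqrt (gauge4 ?w)) = 8 * q * k" for q
    by (simp_all add: k_def)
  have "k * gauge4 ?w = coupling / sqrt (gauge4 ?w)"
    using N by (simp add: k_def)
  then have E: "(mom_X ?w)\<^sup>2 + (mom_Y ?w)\<^sup>2 - k * gauge4 ?w = 0"
    using zero_energy_speed[OF assms(3)] by simp
  note d = hamilton_solution_coords[OF assms(1,2), unfolded kh_field_def fst_conv snd_conv]
  note x = d(1)[of 1, unfolded vector_3] and y = d(1)[of 2, unfolded vector_3] and z = d(1)[of 3, unfolded vector_3]
  note px = d(2)[of 1, unfolded vector_3 k] and py = d(2)[of 2, unfolded vector_3 k]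
    and pz = d(2)[of 3, unfolded vector_3 k]
  define h where "h = half_pz ?w"
  \<comment> \<open>In terms of the horizontal momenta all terms except the kinetic and the potential one cancel.\<close>
  have mom: "px_of ?w = mom_X ?w + y_of ?w * h" "py_of ?w = mom_Y ?w - x_of ?w * h" "pz_of ?w = 2 * h"
    by (simp_all add: mom_X_def mom_Y_def h_def half_pz_def)
  have "((\<lambda>u. dil_momentum (c u)) has_real_derivative (mom_X ?w)\<^sup>2 + (mom_Y ?w)\<^sup>2 - k * gauge4 ?w) (at t)"
    unfolding dil_momentum_def
    by (rule DERIV_cong[OF DERIV_add[OF DERIV_add[OF DERIV_mult[OF x px] DERIV_mult[OF y py]]
            DERIV_mult[OF DERIV_cmult[OF z] pz]]])
      (simp add: mom gauge4_def rsq_def algebra_simps power2_eq_square)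
  then show ?thesis by (simp only: E)
qed

lemma constant_on_interval:
  fixes f :: "real \<Rightarrow> real"
  assumes "is_interval I" "\<And>t. t \<in> I \<Longrightarrow> (f has_real_derivative 0) (at t)"
  shows "\<exists>k. \<forall>t\<in>I. f t = k"
proof (rule has_field_derivative_zero_constant)
  show "convex I" using assms(1) by (rule is_interval_convex)
  show "(f has_real_derivative 0) (at t within I)" if "t \<in> I" for t
    using assms(2)[OF that] by (rule has_field_derivative_at_within)
qed

section \<open>The Lyapunov function\<close>

locale zero_energy_motion =
  fixes I :: "real set" and c :: "real \<Rightarrow> phase" and J P :: real
  assumes sol: "hamilton_solution I c"
    and energy: "\<And>t. t \<in> I \<Longrightarrow> kh_hamiltonian (c t) = 0"
    and off_axis: "\<And>t. t \<in> I \<Longrightarrow> \<not> (x_of (c t) = 0 \<and> y_of (c t) = 0)"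
    and dil: "\<And>t. t \<in> I \<Longrightarrow> dil_momentum (c t) = J"
    and ang: "\<And>t. t \<in> I \<Longrightarrow> ang_momentum (c t) = P"
begin

text \<open>The length of the vector (radial momentum, twist) is determined by energy and position. Turned back by the angle
  whose tangent is \<open>slope\<close> and multiplied by the square of the homogeneous norm it becomes (drift, swing), a vector of length
  \<open>scale\<close>. Its first component is linear in the first integrals and governs the growth of \<open>s\<close>; the direction of this
  vector and \<open>slope\<close> describe the state up to similarity.\<close>

definition drift :: "phase \<Rightarrow> real" where
  "drift w = J * rsq w + 4 * P * z_of w"

definition swing :: "phase \<Rightarrow> real" where
  "swing w = P * rsq w - 4 * J * z_of w + half_pz w * gauge4 w"

definition scale :: "phase \<Rightarrow> real" where
  "scale w = sqrt (coupling * rsq w * sqrt (gauge4 w))"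

definition slope :: "phase \<Rightarrow> real" where
  "slope w = 4 * z_of w / rsq w"

abbreviation "J' \<equiv> J / sqrt coupling"
abbreviation "P' \<equiv> P / sqrt coupling"

context
  fixes t assumes t: "t \<in> I"
begin

lemma rsq_pos: "0 < rsq (c t)"
  using off_axis[OF t] by (simp add: rsq_def sum_power2_gt_zero_iff)

lemma gauge4_pos_on_orbit: "0 < gauge4 (c t)"
  using rsq_pos by (simp add: gauge4_def add_pos_nonneg)

lemma scale_pos: "0 < scale (c t)"
  using rsq_pos gauge4_pos_on_orbit by (simp add: scale_def)

lemma scale_sq: "(scale (c t))\<^sup>2 = coupling * rsq (c t) * sqrt (gauge4 (c t))"
  using rsq_pos gauge4_pos_on_orbit by (simp add: scale_def)

lemma momenta:
  "J = rad_momentum (c t) + 4 * z_of (c t) * half_pz (c t)"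
  "P = twist (c t) - rsq (c t) * half_pz (c t)"
  using dil[OF t] ang[OF t] by (simp_all add: dil_momentum_def rad_momentum_def twist_def half_pz_def)

lemma speed_level:
  "(rad_momentum (c t))\<^sup>2 + (twist (c t))\<^sup>2 = coupling * rsq (c t) / sqrt (gauge4 (c t))"
proof -
  let ?w = "c t"
  have mom: "mom_X ?w = px_of ?w - y_of ?w * half_pz ?w" "mom_Y ?w = py_of ?w + x_of ?w * half_pz ?w"
    by (simp_all add: mom_X_def mom_Y_def half_pz_def)
  have "(rad_momentum ?w)\<^sup>2 + (twist ?w)\<^sup>2 = rsq ?w * ((mom_X ?w)\<^sup>2 + (mom_Y ?w)\<^sup>2)"
    unfolding mom rad_momentum_def twist_def ang_momentum_def rsq_def by algebra
  then show ?thesis by (simp add: zero_energy_speed[OF energy[OF t]])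
qed

lemma drift_eq: "drift (c t) = rsq (c t) * rad_momentum (c t) + 4 * z_of (c t) * twist (c t)"
  unfolding drift_def unfolding momenta by (simp add: algebra_simps)

lemma swing_eq: "swing (c t) = rsq (c t) * twist (c t) - 4 * z_of (c t) * rad_momentum (c t)"
  unfolding swing_def unfolding momenta gauge4_def by (simp add: algebra_simps power2_eq_square)

lemma drift_swing_level: "(drift (c t))\<^sup>2 + (swing (c t))\<^sup>2 = (scale (c t))\<^sup>2"
proof -
  let ?w = "c t"
  have "(drift ?w)\<^sup>2 + (swing ?w)\<^sup>2 = gauge4 ?w * ((rad_momentum ?w)\<^sup>2 + (twist ?w)\<^sup>2)"
    unfolding drift_eq swing_eq gauge4_def by algebra
  also have "\<dots> = coupling * rsq ?w * (gauge4 ?w / sqrt (gauge4 ?w))"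
    unfolding speed_level by simp
  also have "\<dots> = (scale ?w)\<^sup>2"
    using gauge4_pos_on_orbit by (simp add: scale_sq real_div_sqrt)
  finally show ?thesis .
qed

lemma brk_slope: "brk (slope (c t)) = sqrt (sqrt (gauge4 (c t)) / rsq (c t))"
proof -
  have "1 + (slope (c t))\<^sup>2 = gauge4 (c t) / (rsq (c t))\<^sup>2"
    using rsq_pos by (simp add: slope_def gauge4_def field_simps)
  then show ?thesis using rsq_pos by (simp add: brk_def real_sqrt_divide)
qed

lemma scale_slope: "rsq (c t) * (sqrt coupling * brk (slope (c t))) = scale (c t)"
proof -
  have "rsq (c t) * (sqrt coupling * brk (slope (c t))) = sqrt coupling * (rsq (c t) / sqrt (rsq (c t))) * sqrt (sqrt (gauge4 (c t)))"
    unfolding brk_slope by (simp add: real_sqrt_divide)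
  also have "\<dots> = scale (c t)"
    unfolding scale_def real_sqrt_mult real_div_sqrt[OF less_imp_le[OF rsq_pos]] ..
  finally show ?thesis .
qed

lemma profile_slope: "profile J' P' (slope (c t)) = drift (c t) / scale (c t)"
proof -
  have "profile J' P' (slope (c t)) = (J + P * slope (c t)) / (sqrt coupling * brk (slope (c t)))"
    by (simp add: profile_def add_divide_distrib)
  also have "\<dots> = rsq (c t) * (J + P * slope (c t)) / (rsq (c t) * (sqrt coupling * brk (slope (c t))))"
    using rsq_pos by simp
  also have "rsq (c t) * (J + P * slope (c t)) = drift (c t)"
    using rsq_pos by (simp add: drift_def slope_def field_simps)
  finally show ?thesis by (simp only: scale_slope)
qed

lemma turning_slope:
  "turning J' P' (slope (c t)) =
     (2 * P * (rsq (c t))\<^sup>2 + 16 * P * (z_of (c t))\<^sup>2 - 4 * J * z_of (c t) * rsq (c t)) / (rsq (c t) * scale (c t))"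
    (is "_ = ?K / _")
proof -
  have "turning J' P' (slope (c t)) = (P * (2 + (slope (c t))\<^sup>2) - J * slope (c t)) / (sqrt coupling * brk (slope (c t)))"
    by (simp add: turning_def diff_divide_distrib)
  also have "\<dots> = (rsq (c t))\<^sup>2 * (P * (2 + (slope (c t))\<^sup>2) - J * slope (c t))
      / (rsq (c t) * (rsq (c t) * (sqrt coupling * brk (slope (c t)))))"
    using rsq_pos by (simp add: power2_eq_square)
  also have "(rsq (c t))\<^sup>2 * (P * (2 + (slope (c t))\<^sup>2) - J * slope (c t)) = ?K"
    using rsq_pos by (simp add: slope_def field_simps power2_eq_square)
  finally show ?thesis by (simp only: scale_slope)
qed

lemma gauge4_deriv: "((\<lambda>u. gauge4 (c u)) has_real_derivative 4 * drift (c t)) (at t)"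
proof -
  note d = hamilton_solution_rsq_z_pz[OF sol t]
  have "((\<lambda>u. gauge4 (c u)) has_real_derivative
      2 * rsq (c t) * (2 * rad_momentum (c t)) + 16 * (2 * z_of (c t) * (1/2 * twist (c t)))) (at t)"
    unfolding gauge4_def by (auto intro!: derivative_eq_intros d)
  moreover have "2 * rsq (c t) * (2 * rad_momentum (c t)) + 16 * (2 * z_of (c t) * (1/2 * twist (c t))) = 4 * drift (c t)"
    unfolding drift_eq by (simp add: algebra_simps)
  ultimately show ?thesis by (simp only:)
qed

lemma s_deriv: "((\<lambda>u. s_fun (c u)) has_real_derivative drift (c t) / gauge4 (c t)) (at t)"
  unfolding s_fun_gauge4
  by (rule DERIV_cong[OF DERIV_cmult[OF DERIV_chain2[OF DERIV_ln[OF gauge4_pos_on_orbit] gauge4_deriv]]])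
    (simp add: field_simps)

lemma scale_deriv:
  "((\<lambda>u. scale (c u)) has_real_derivative
      scale (c t) * (rad_momentum (c t) / rsq (c t) + drift (c t) / gauge4 (c t))) (at t)"
proof -
  let ?w = "c t"
  let ?D = "sqrt (gauge4 ?w)"
  note d = hamilton_solution_rsq_z_pz[OF sol t]
  have D: "0 < ?D" "gauge4 ?w = ?D * ?D" using gauge4_pos_on_orbit by auto
  have D': "((\<lambda>u. sqrt (gauge4 (c u))) has_real_derivative 2 * drift ?w / ?D) (at t)"
    using gauge4_pos_on_orbit by (auto intro!: derivative_eq_intros gauge4_deriv simp: field_simps)
  have "((\<lambda>u. coupling * rsq (c u) * sqrt (gauge4 (c u))) has_real_derivative
      coupling * (2 * rad_momentum ?w * ?D + rsq ?w * (2 * drift ?w / ?D))) (at t)"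
    by (rule DERIV_cong[OF DERIV_mult[OF DERIV_cmult[OF d(1)] D']]) (simp add: algebra_simps)
  moreover have "coupling * (2 * rad_momentum ?w * ?D + rsq ?w * (2 * drift ?w / ?D))
      = 2 * (scale ?w)\<^sup>2 * (rad_momentum ?w / rsq ?w + drift ?w / gauge4 ?w)"
  proof -
    have "k * (2 * a * d + r * (2 * m / d)) = 2 * (k * r * d) * (a / r + m / (d * d))"
      if "d \<noteq> 0" "r \<noteq> 0" for k a d r m :: real
      using that by (simp add: field_simps)
    from this[of ?D "rsq ?w" coupling "rad_momentum ?w" "drift ?w"] show ?thesis
      using D(1) rsq_pos unfolding scale_sq D(2)[symmetric] by simp
  qed
  ultimately have L: "((\<lambda>u. coupling * rsq (c u) * sqrt (gauge4 (c u))) has_real_derivative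
      2 * (scale ?w)\<^sup>2 * (rad_momentum ?w / rsq ?w + drift ?w / gauge4 ?w)) (at t)"
    by (simp only:)
  have pos: "0 < coupling * rsq ?w * sqrt (gauge4 ?w)" using rsq_pos gauge4_pos_on_orbit by simp
  have "((\<lambda>u. scale (c u)) has_real_derivative
      inverse (scale ?w) / 2 * (2 * (scale ?w)\<^sup>2 * (rad_momentum ?w / rsq ?w + drift ?w / gauge4 ?w))) (at t)"
    unfolding scale_def[of "c _"]
    using DERIV_chain2[OF DERIV_real_sqrt[OF pos] L] by (simp add: scale_def)
  moreover have "inverse r / 2 * (2 * r\<^sup>2 * q) = r * q" if "0 < r" for r q :: real
    using that by (simp add: power2_eq_square field_simps)
  ultimately show ?thesis by (simp only: scale_pos)
qed

lemma swing_deriv: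
  "((\<lambda>u. swing (c u)) has_real_derivative
      2 * half_pz (c t) * drift (c t) - 4 * z_of (c t) * (scale (c t))\<^sup>2 / (rsq (c t) * gauge4 (c t))) (at t)"
proof -
  let ?w = "c t"
  let ?D = "sqrt (gauge4 ?w)"
  note d = hamilton_solution_rsq_z_pz[OF sol t]
  define f where "f = coupling / ?D"
  have f: "4 * coupling * z_of ?w / (gauge4 ?w * ?D) * gauge4 ?w = 4 * z_of ?w * f"
    using gauge4_pos_on_orbit by (simp add: f_def)
  have "(scale ?w)\<^sup>2 / (rsq ?w * gauge4 ?w) = coupling * (sqrt (gauge4 ?w) / gauge4 ?w)"
    using rsq_pos by (simp add: scale_sq)
  also have "\<dots> = f"
    unfolding sqrt_divide_self_eq[OF less_imp_le[OF gauge4_pos_on_orbit]] f_def by (rule divide_inverse[symmetric])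
  finally have f': "(scale ?w)\<^sup>2 / (rsq ?w * gauge4 ?w) = f" .
  have g: "4 * z_of ?w * (scale ?w)\<^sup>2 / (rsq ?w * gauge4 ?w) = 4 * z_of ?w * f"
    unfolding f'[symmetric] by (rule times_divide_eq_right[symmetric])
  have "((\<lambda>u. swing (c u)) has_real_derivative
      P * (2 * rad_momentum ?w) - 4 * J * (1/2 * twist ?w)
       + (- (4 * coupling * z_of ?w / (gauge4 ?w * ?D)) * gauge4 ?w + 4 * drift ?w * half_pz ?w)) (at t)"
    unfolding swing_def
    by (intro DERIV_cong[OF DERIV_add[OF DERIV_diff[OF DERIV_cmult[OF d(1)] DERIV_cmult[OF d(2)]]
            DERIV_mult[OF d(3) gauge4_deriv]]]) simp
  moreover have "- (4 * coupling * z_of ?w / (gauge4 ?w * ?D)) * gauge4 ?w = - 4 * z_of ?w * f"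
    using f by simp
  moreover have "P * (2 * rad_momentum ?w) - 4 * J * (1/2 * twist ?w) = - (2 * half_pz ?w * drift ?w)"
    unfolding drift_eq unfolding momenta by (simp add: algebra_simps)
  ultimately show ?thesis
    by (elim DERIV_cong) (simp only: g, simp)
qed

text \<open>The drift is a factor of this rate as well as of the rate of \<open>s\<close>, which makes it possible to correct
  \<open>s\<close> by a function of \<open>swing / scale\<close>.\<close>

lemma phase_angle_deriv:
  "((\<lambda>u. swing (c u) / scale (c u)) has_real_derivative
      - (drift (c t) / gauge4 (c t) * turning J' P' (slope (c t)))) (at t)"
proof -
  let ?w = "c t"
  let ?S = "scale ?w" and ?R = "rsq ?w" and ?N = "gauge4 ?w" and ?M = "drift ?w" and ?W = "swing ?w"
  let ?K = "2 * P * ?R\<^sup>2 + 16 * P * (z_of ?w)\<^sup>2 - 4 * J * z_of ?w * ?R"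
  note pos = rsq_pos gauge4_pos_on_orbit scale_pos
  have "((\<lambda>u. swing (c u) / scale (c u)) has_real_derivative
     ((2 * half_pz ?w * ?M - 4 * z_of ?w * ?S\<^sup>2 / (?R * ?N)) * ?S - ?W * (?S * (rad_momentum ?w / ?R + ?M / ?N))) / (?S * ?S)) (at t)"
    using pos by (intro DERIV_divide swing_deriv scale_deriv) auto
  also have "((2 * half_pz ?w * ?M - 4 * z_of ?w * ?S\<^sup>2 / (?R * ?N)) * ?S - ?W * (?S * (rad_momentum ?w / ?R + ?M / ?N))) / (?S * ?S)
     = (2 * half_pz ?w * ?M - 4 * z_of ?w * ?S\<^sup>2 / (?R * ?N) - ?W * (rad_momentum ?w / ?R + ?M / ?N)) / ?S"
    using pos by (simp add: field_simps)
  also have "2 * half_pz ?w * ?M - 4 * z_of ?w * ?S\<^sup>2 / (?R * ?N) - ?W * (rad_momentum ?w / ?R + ?M / ?N)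
     = (2 * half_pz ?w * ?M * ?R * ?N - 4 * z_of ?w * ?S\<^sup>2 - ?W * (rad_momentum ?w * ?N + ?M * ?R)) / (?R * ?N)"
    using pos by (simp add: field_simps)
  also have "2 * half_pz ?w * ?M * ?R * ?N - 4 * z_of ?w * ?S\<^sup>2 - ?W * (rad_momentum ?w * ?N + ?M * ?R) = - (?M * ?K)"
  proof -
    have "rad_momentum ?w * ?N = ?R * ?M - 4 * z_of ?w * ?W"
      unfolding drift_eq swing_eq gauge4_def by algebra
    moreover have "2 * half_pz ?w * ?R * ?N - 4 * z_of ?w * ?M - 2 * ?R * ?W = - ?K"
      unfolding drift_def swing_def by algebra
    ultimately show ?thesis
      unfolding drift_swing_level[symmetric] by algebra
  qed
  finally show ?thesis
    unfolding turning_slope using pos by (elim DERIV_cong) (simp add: field_simps)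
qed

end

text \<open>The function is \<open>V = s + \<Omega> (swing / scale)\<close> with \<open>\<Omega>\<close> an antiderivative of a comparison weight. It stays
  within a bounded distance from \<open>s\<close>, because \<open>\<Omega>\<close> is continuous and its argument lies in \<open>[-1, 1]\<close>.\<close>

proposition lyapunov_function:
  "\<exists>V. (\<exists>B. \<forall>t\<in>I. \<bar>V t - s_fun (c t)\<bar> \<le> B) \<and>
       (\<forall>t\<in>I. \<forall>u\<in>I. swing (c t) / scale (c t) = swing (c u) / scale (c u) \<longrightarrow>
          V t - s_fun (c t) = V u - s_fun (c u)) \<and>
       (\<forall>t\<in>I. \<exists>v. (V has_real_derivative v) (at t) \<and> 0 \<le> J * v \<and> (J = 0 \<longrightarrow> v = 0) \<and>
          (z_of (c t) = 0 \<and> J \<noteq> 0 \<longrightarrow> 0 < J * v))"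
proof -
  obtain \<kappa> where \<kappa>: "comparison_weight J' P' \<kappa>" using comparison_weight_exists by blast
  \<comment> \<open>On a larger interval, so that the antiderivative is differentiable from both sides at the endpoints 1 and -1.\<close>
  then have "continuous_on {-2..2} \<kappa>"
    unfolding comparison_weight_def by (blast intro: continuous_on_subset)
  then obtain \<Omega> where \<Omega>: "\<And>a. a \<in> {-2..2} \<Longrightarrow> (\<Omega> has_real_derivative \<kappa> a) (at a within {-2..2})"
    using antiderivative_continuous[of "-2" 2 \<kappa>] by (auto simp: has_real_derivative_iff_has_vector_derivative)
  have \<Omega>': "(\<Omega> has_real_derivative \<kappa> a) (at a)" if "\<bar>a\<bar> \<le> 1" for a
    using \<Omega>[of a] that at_within_interior[of a "{-2..2}"] by (auto simp: abs_le_iff)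
  have "continuous_on {-1..1} \<Omega>"
    by (intro continuous_at_imp_continuous_on ballI DERIV_isCont[OF \<Omega>']) (auto simp: abs_le_iff)
  then have "bounded (\<Omega> ` {-1..1})"
    by (intro compact_imp_bounded compact_continuous_image) auto
  then obtain B where B: "\<And>a. a \<in> {-1..1} \<Longrightarrow> \<bar>\<Omega> a\<bar> \<le> B"
    unfolding bounded_iff real_norm_def by blast
  have level: "(profile J' P' (slope (c t)))\<^sup>2 + (swing (c t) / scale (c t))\<^sup>2 = 1" if "t \<in> I" for t
    using drift_swing_level[OF that] scale_pos[OF that]
    by (simp add: profile_slope[OF that] power_divide add_divide_distrib[symmetric])
  have le1: "\<bar>swing (c t) / scale (c t)\<bar> \<le> 1" if "t \<in> I" for t
  proof -
    have "(swing (c t) / scale (c t))\<^sup>2 \<le> 1"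
      using level[OF that] zero_le_power2[of "profile J' P' (slope (c t))"] by linarith
    then show ?thesis by (simp add: abs_square_le_1)
  qed
  define V where "V = (\<lambda>u. s_fun (c u) + \<Omega> (swing (c u) / scale (c u)))"
  have deriv: "\<exists>v. (V has_real_derivative v) (at t) \<and> 0 \<le> J * v \<and> (J = 0 \<longrightarrow> v = 0) \<and>
      (z_of (c t) = 0 \<and> J \<noteq> 0 \<longrightarrow> 0 < J * v)" if t: "t \<in> I" for t
  proof -
    let ?a = "swing (c t) / scale (c t)" and ?u = "slope (c t)"
    define E where "E = profile J' P' ?u * (1 - \<kappa> ?a * turning J' P' ?u)"
    define v where "v = drift (c t) / gauge4 (c t) + \<kappa> ?a * - (drift (c t) / gauge4 (c t) * turning J' P' ?u)"
    have "(V has_real_derivative v) (at t)"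
      unfolding v_def V_def
      by (intro DERIV_add s_deriv[OF t] DERIV_chain2[OF \<Omega>'[OF le1[OF t]] phase_angle_deriv[OF t]])
    moreover have v: "v = scale (c t) / gauge4 (c t) * E"
    proof -
      have "m / n + k * - (m / n * T) = r / n * (m / r * (1 - k * T))" if "0 < r" "0 < n" for m n k T r :: real
        using that by (simp add: field_simps)
      then show ?thesis unfolding v_def E_def profile_slope[OF t] using scale_pos[OF t] gauge4_pos_on_orbit[OF t] .
    qed
    have k: "0 < scale (c t) / gauge4 (c t) * sqrt coupling"
      using scale_pos[OF t] gauge4_pos_on_orbit[OF t] by simp
    have Jv: "J * v = (scale (c t) / gauge4 (c t) * sqrt coupling) * (J' * E)"
      unfolding v by simp
    have E: "0 \<le> J' * E \<and> (J' = 0 \<longrightarrow> E = 0) \<and> (?u = 0 \<and> J' \<noteq> 0 \<longrightarrow> 0 < J' * E)"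
      using \<kappa> level[OF t] unfolding comparison_weight_def E_def Let_def by blast
    have J': "J' = 0 \<longleftrightarrow> J = 0" by simp
    have "0 \<le> J * v"
      unfolding Jv using E by (intro mult_nonneg_nonneg[OF less_imp_le[OF k]]) blast
    moreover have "J = 0 \<longrightarrow> v = 0" unfolding v using E J' by (metis mult_zero_right)
    moreover have "0 < J * v" if "z_of (c t) = 0 \<and> J \<noteq> 0"
    proof -
      have "?u = 0" using that by (simp add: slope_def)
      then show ?thesis unfolding Jv using E J' that by (intro mult_pos_pos[OF k]) blast
    qed
    ultimately show ?thesis by blast
  qed
  have "\<bar>V t - s_fun (c t)\<bar> \<le> B" if "t \<in> I" for t
    using B[of "swing (c t) / scale (c t)"] le1[OF that, unfolded abs_le_iff] by (simp add: V_def)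
  then show ?thesis
    using deriv by (intro exI[of _ V] conjI) (auto simp: V_def)
qed

end

section \<open>Ends of the interval and zeros of functions\<close>

text \<open>The end of an open interval does not belong to it, so in the extended reals, where the end always exists,
  its left neighbourhoods meet the reals exactly in final segments of the interval.\<close>

lemma eventually_future_end:
  assumes "open I" "is_interval I" "I \<noteq> {}"
  shows "eventually Q (future_end I) \<longleftrightarrow> (\<exists>a\<in>I. \<forall>t\<in>I. a < t \<longrightarrow> Q t)"
proof -
  define L where "L = (SUP t\<in>I. ereal t)"
  have below: "ereal t < L" if t: "t \<in> I" for t
  proof -
    obtain e where "0 < e" "ball t e \<subseteq> I" using openE[OF assms(1) t] .
    then have "t + e / 2 \<in> I" by (auto simp: dist_real_def subset_iff)
    then have "ereal (t + e / 2) \<le> L" unfolding L_def by (rule SUP_upper)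
    moreover have "ereal t < ereal (t + e / 2)" using \<open>0 < e\<close> by simp
    ultimately show ?thesis by (rule less_le_trans[rotated])
  qed
  have above: "\<exists>t\<in>I. b < ereal t" if "b < L" for b
    using that by (auto simp: L_def less_SUP_iff)
  have between: "t \<in> I" if a: "a \<in> I" "a < t" "ereal t < L" for a t
  proof -
    obtain u where "u \<in> I" "t < u" using above[OF a(3)] by auto
    then show ?thesis using mem_is_interval_1_I[OF assms(2) a(1) \<open>u \<in> I\<close>, of t] a(2) by simp
  qed
  obtain a0 where "a0 \<in> I" using assms(3) by blast
  note at_left = eventually_at_left[OF below[OF this]]
  show ?thesis
  proof
    assume "eventually Q (future_end I)"
    then obtain Q' where Q': "eventually Q' (at_left L)" "\<And>t. Q' (ereal t) \<Longrightarrow> Q t"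
      unfolding future_end_def L_def[symmetric] eventually_filtercomap by blast
    then obtain b where b: "b < L" "\<And>y. b < y \<Longrightarrow> y < L \<Longrightarrow> Q' y"
      unfolding at_left by blast
    obtain a where a: "a \<in> I" "b < ereal a" using above[OF b(1)] by blast
    have "Q t" if "t \<in> I" "a < t" for t
      using Q'(2) b(2)[OF less_trans[OF a(2)] below[OF that(1)]] that(2) by simp
    then show "\<exists>a\<in>I. \<forall>t\<in>I. a < t \<longrightarrow> Q t" using a(1) by blast
  next
    assume "\<exists>a\<in>I. \<forall>t\<in>I. a < t \<longrightarrow> Q t"
    then obtain a where a: "a \<in> I" "\<And>t. t \<in> I \<Longrightarrow> a < t \<Longrightarrow> Q t" by blast
    have "eventually (\<lambda>y. \<forall>t. y = ereal t \<longrightarrow> Q t) (at_left L)"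
      unfolding at_left using below[OF a(1)] between[OF a(1)] a(2) by (intro exI[of _ "ereal a"]) auto
    then show "eventually Q (future_end I)"
      unfolding future_end_def L_def[symmetric] eventually_filtercomap by blast
  qed
qed

lemma eventually_past_end:
  assumes "open I" "is_interval I" "I \<noteq> {}"
  shows "eventually Q (past_end I) \<longleftrightarrow> (\<exists>a\<in>I. \<forall>t\<in>I. t < a \<longrightarrow> Q t)"
proof -
  define L where "L = (INF t\<in>I. ereal t)"
  have above: "L < ereal t" if t: "t \<in> I" for t
  proof -
    obtain e where "0 < e" "ball t e \<subseteq> I" using openE[OF assms(1) t] .
    then have "t - e / 2 \<in> I" by (auto simp: dist_real_def subset_iff)
    then have "L \<le> ereal (t - e / 2)" unfolding L_def by (rule INF_lower)
    moreover have "ereal (t - e / 2) < ereal t" using \<open>0 < e\<close> by simp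
    ultimately show ?thesis by (rule le_less_trans)
  qed
  have below: "\<exists>t\<in>I. ereal t < b" if "L < b" for b
    using that by (auto simp: L_def INF_less_iff)
  have between: "t \<in> I" if a: "a \<in> I" "t < a" "L < ereal t" for a t
  proof -
    obtain u where "u \<in> I" "u < t" using below[OF a(3)] by auto
    then show ?thesis using mem_is_interval_1_I[OF assms(2) \<open>u \<in> I\<close> a(1), of t] a(2) by simp
  qed
  obtain a0 where "a0 \<in> I" using assms(3) by blast
  note at_right = eventually_at_right[OF above[OF this]]
  show ?thesis
  proof
    assume "eventually Q (past_end I)"
    then obtain Q' where Q': "eventually Q' (at_right L)" "\<And>t. Q' (ereal t) \<Longrightarrow> Q t"
      unfolding past_end_def L_def[symmetric] eventually_filtercomap by blast
    then obtain b where b: "L < b" "\<And>y. L < y \<Longrightarrow> y < b \<Longrightarrow> Q' y"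
      unfolding at_right by blast
    obtain a where a: "a \<in> I" "ereal a < b" using below[OF b(1)] by blast
    have "Q t" if "t \<in> I" "t < a" for t
      using Q'(2) b(2)[OF above[OF that(1)] less_trans[OF _ a(2)]] that(2) by simp
    then show "\<exists>a\<in>I. \<forall>t\<in>I. t < a \<longrightarrow> Q t" using a(1) by blast
  next
    assume "\<exists>a\<in>I. \<forall>t\<in>I. t < a \<longrightarrow> Q t"
    then obtain a where a: "a \<in> I" "\<And>t. t \<in> I \<Longrightarrow> t < a \<Longrightarrow> Q t" by blast
    have "eventually (\<lambda>y. \<forall>t. y = ereal t \<longrightarrow> Q t) (at_right L)"
      unfolding at_right using above[OF a(1)] between[OF a(1)] a(2) by (intro exI[of _ "ereal a"]) auto
    then show "eventually Q (past_end I)"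
      unfolding past_end_def L_def[symmetric] eventually_filtercomap by blast
  qed
qed

text \<open>A function that leaves a zero upwards is positive until its next zero and cannot also rise into it.\<close>

lemma no_upcrossing_at_next_zero:
  fixes f :: "real \<Rightarrow> real"
  assumes "a < b" "f a = 0" "f b = 0" "\<And>t. a < t \<Longrightarrow> t < b \<Longrightarrow> f t \<noteq> 0"
    and cont: "continuous_on {a..b} f"
    and "(f has_real_derivative d) (at a)" "0 < d" "(f has_real_derivative e) (at b)"
  shows "e \<le> 0"
proof (rule ccontr)
  assume "\<not> e \<le> 0"
  then obtain \<epsilon> where \<epsilon>: "0 < \<epsilon>" "\<And>h. 0 < h \<Longrightarrow> h < \<epsilon> \<Longrightarrow> f (b - h) < 0"
    using DERIV_pos_inc_left[OF assms(8)] assms(3) by auto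
  obtain \<delta> where \<delta>: "0 < \<delta>" "\<And>h. 0 < h \<Longrightarrow> h < \<delta> \<Longrightarrow> 0 < f (a + h)"
    using DERIV_pos_inc_right[OF assms(6,7)] assms(2) by auto
  define h where "h = min (min (\<delta> / 2) (\<epsilon> / 2)) ((b - a) / 3)"
  have h: "0 < h" "h < \<delta>" "h < \<epsilon>"
    using \<delta>(1) \<epsilon>(1) assms(1) by (auto simp: h_def)
  moreover have "h \<le> (b - a) / 3" by (simp only: h_def min.cobounded2)
  ultimately have ab: "a < a + h" "a + h < b - h" "b - h < b" by auto
  have "continuous_on {a + h..b - h} f"
    using cont by (rule continuous_on_subset) (use ab in auto)
  then obtain t where "a + h \<le> t" "t \<le> b - h" "f t = 0"
    using IVT2'[of f "b - h" 0 "a + h"] \<delta>(2)[OF h(1,2)] \<epsilon>(2)[OF h(1,3)] ab by auto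
  then show False using assms(4)[of t] ab by auto
qed

text \<open>Small values of the homogeneous norm force all three coordinates to be small. The points over the
  origin are excluded since \<open>ln 0 = 0\<close> gives them the value 0 of \<open>s_fun\<close>.\<close>

lemma tendsto_origin_of_s_fun:
  assumes "eventually (\<lambda>t. fst (c t) \<noteq> 0) F"
    and "\<And>K. eventually (\<lambda>t. s_fun (c t) < K) F"
  shows "((\<lambda>t. fst (c t)) \<longlongrightarrow> 0) F"
proof (rule vec_tendstoI, rule tendstoI)
  fix i :: 3 and e :: real assume "0 < e"
  define m where "m = min (e ^ 4) (16 * e\<^sup>2)"
  have m: "0 < m" using \<open>0 < e\<close> by (simp add: m_def)
  have "eventually (\<lambda>t. fst (c t) \<noteq> 0 \<and> s_fun (c t) < 1/4 * ln m) F"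
    by (intro eventually_conj assms)
  then show "eventually (\<lambda>t. dist (fst (c t) $ i) (0 $ i) < e) F"
  proof eventually_elim
    case (elim t)
    define N where "N = ((x_of (c t))\<^sup>2 + (y_of (c t))\<^sup>2)\<^sup>2 + 16 * (z_of (c t))\<^sup>2"
    have "N < m"
    proof (cases "0 < N")
      case True
      have "ln N < ln m" using elim by (simp add: s_fun_def N_def)
      then show ?thesis using True m by simp
    qed (use m in simp)
    moreover have "(x_of (c t)) ^ 4 \<le> N" "(y_of (c t)) ^ 4 \<le> N" "16 * (z_of (c t))\<^sup>2 \<le> N"
      by (simp_all add: N_def power2_sum flip: power_mult)
    ultimately have *: "\<bar>x_of (c t)\<bar> ^ 4 < e ^ 4" "\<bar>y_of (c t)\<bar> ^ 4 < e ^ 4" "\<bar>z_of (c t)\<bar>\<^sup>2 < e\<^sup>2"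
      by (simp_all add: m_def power_even_abs)
    have "a < e" if "a ^ n < e ^ n" for a n
      using that \<open>0 < e\<close> by (intro power_less_imp_less_base[of a n e]) auto
    from this[OF *(1)] this[OF *(2)] this[OF *(3)] show ?case using exhaust_3[of i] by (auto simp: dist_real_def)
  qed
qed

lemma not_Bfun_of_s_fun:
  assumes "F \<noteq> bot" and large: "\<And>K. eventually (\<lambda>t. K < s_fun (c t)) F"
  shows "\<not> Bfun (\<lambda>t. fst (c t)) F"
proof
  assume "Bfun (\<lambda>t. fst (c t)) F"
  then obtain K where K: "0 < K" "eventually (\<lambda>t. norm (fst (c t)) \<le> K) F"
    by (auto simp: Bfun_def)
  define M where "M = (K\<^sup>2 + K\<^sup>2)\<^sup>2 + 16 * K\<^sup>2"
  have "eventually (\<lambda>t. norm (fst (c t)) \<le> K \<and> 0 < s_fun (c t) \<and> 1/4 * ln M < s_fun (c t)) F"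
    by (intro eventually_conj K(2) large)
  then have "eventually (\<lambda>t. False) F"
  proof eventually_elim
    case (elim t)
    define N where "N = ((x_of (c t))\<^sup>2 + (y_of (c t))\<^sup>2)\<^sup>2 + 16 * (z_of (c t))\<^sup>2"
    have s: "s_fun (c t) = 1/4 * ln N" by (simp add: s_fun_def N_def)
    have "(fst (c t) $ i)\<^sup>2 \<le> K\<^sup>2" for i
      using component_le_norm_cart[of "fst (c t)" i] elim by (intro abs_le_square_iff[THEN iffD1]) auto
    note q = this
    have "((x_of (c t))\<^sup>2 + (y_of (c t))\<^sup>2)\<^sup>2 \<le> (K\<^sup>2 + K\<^sup>2)\<^sup>2"
      by (rule power_mono[OF add_mono[OF q q]]) simp
    then have "N \<le> M"
      unfolding N_def M_def using q[of 3] by linarith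
    moreover have "0 < N"
    proof -
      have "0 \<le> N" by (simp add: N_def)
      moreover have "N \<noteq> 0" using elim unfolding s by auto
      ultimately show ?thesis by simp
    qed
    ultimately have "ln N \<le> ln M" by simp
    then show False using elim unfolding s by simp
  qed
  then show False using assms(1) by simp
qed

section \<open>Return of the motion after a full oscillation\<close>

lemma similarity_inverse:
  assumes "0 < \<mu>"
  shows "similarity (- \<phi>) (1 / \<mu>) (similarity \<phi> \<mu> w) = w"
proof -
  have cs: "cos \<phi> * (cos \<phi> * a + sin \<phi> * b) + sin \<phi> * (sin \<phi> * a - cos \<phi> * b) = a" for a b :: real
  proof -
    have "cos \<phi> * (cos \<phi> * a + sin \<phi> * b) + sin \<phi> * (sin \<phi> * a - cos \<phi> * b) = ((cos \<phi>)\<^sup>2 + (sin \<phi>)\<^sup>2) * a"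
      by algebra
    then show ?thesis by simp
  qed
  have *: "1 / \<mu> * (a * (\<mu> * x) - b * (\<mu> * y)) = a * x - b * y" "1 / \<mu> * (a * (\<mu> * x) + b * (\<mu> * y)) = a * x + b * y"
    "(a * (x / \<mu>) - b * (y / \<mu>)) / (1 / \<mu>) = a * x - b * y" "(a * (x / \<mu>) + b * (y / \<mu>)) / (1 / \<mu>) = a * x + b * y"
    for a b x y :: real using assms by (simp_all add: field_simps)
  have rot: "cos \<phi> * (cos \<phi> * x - sin \<phi> * y) - - sin \<phi> * (sin \<phi> * x + cos \<phi> * y) = x"
    "- sin \<phi> * (cos \<phi> * x - sin \<phi> * y) + cos \<phi> * (sin \<phi> * x + cos \<phi> * y) = y" for x y :: real
    using cs[of x "- y"] cs[of y x] by (simp_all add: algebra_simps)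
  show ?thesis
    unfolding phase_eq_iff similarity_coords cos_minus sin_minus * rot
    using assms by (simp add: power_one_over)
qed

lemma s_fun_similarity:
  assumes "0 < \<mu>" "fst w \<noteq> 0"
  shows "s_fun (similarity \<phi> \<mu> w) = s_fun w + ln \<mu>"
  using assms gauge4_pos[OF assms(2)]
  by (simp add: s_fun_gauge4 ln_mult ln_realpow)

context zero_energy_motion
begin

lemma at_z_zero:
  assumes t: "t \<in> I" and z: "z_of (c t) = 0"
  shows "rad_momentum (c t) = J" "(twist (c t))\<^sup>2 = coupling - J\<^sup>2"
    "swing (c t) / scale (c t) = twist (c t) / sqrt coupling"
    "rsq (c t) = exp (2 * s_fun (c t))"
proof -
  have R: "0 < rsq (c t)" using rsq_pos[OF t] .
  have N: "gauge4 (c t) = (rsq (c t))\<^sup>2" using z by (simp add: gauge4_def)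
  show rad: "rad_momentum (c t) = J" using momenta(1)[OF t] z by simp
  show "(twist (c t))\<^sup>2 = coupling - J\<^sup>2"
    using speed_level[OF t] R unfolding rad N by simp
  have "scale (c t) = sqrt (coupling * (rsq (c t))\<^sup>2)"
    using R by (simp add: scale_def N power2_eq_square)
  also have "\<dots> = sqrt coupling * rsq (c t)"
    using R by (simp only: real_sqrt_mult real_sqrt_abs abs_of_pos)
  finally have "scale (c t) = sqrt coupling * rsq (c t)" .
  then show "swing (c t) / scale (c t) = twist (c t) / sqrt coupling"
    using R swing_eq[OF t] z by simp
  have "2 * s_fun (c t) = ln (rsq (c t))"
    using R by (simp add: s_fun_gauge4 N ln_realpow)
  then show "rsq (c t) = exp (2 * s_fun (c t))" using R by simp
qed

text \<open>Where \<open>z = 0\<close> the energy determines the square of the twist, which is twice the velocity of z. If it is not 0,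
  then z crosses 0 alternately upwards and downwards, so the twist is the same at the first and the third zero; if it
  is 0, then it is 0 at every zero.\<close>

lemma twist_returns:
  assumes zeros: "consecutive_z_zeros I c t0 t1 t2"
  shows "t0 \<in> I" "t2 \<in> I" "t0 < t2" "z_of (c t0) = 0" "z_of (c t2) = 0" "twist (c t2) = twist (c t0)"
proof -
  have order: "t0 < t1" "t1 < t2" and Z: "z_zeros I c \<inter> {t0..t2} = {t0, t1, t2}"
    using zeros by (auto simp: consecutive_z_zeros_def)
  have in_Z: "t0 \<in> z_zeros I c" "t1 \<in> z_zeros I c" "t2 \<in> z_zeros I c"
    using Z by blast+
  then show I: "t0 \<in> I" "t2 \<in> I" and z: "z_of (c t0) = 0" "z_of (c t2) = 0"
    by (auto simp: z_zeros_def)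
  have t1: "t1 \<in> I" "z_of (c t1) = 0" using in_Z(2) by (auto simp: z_zeros_def)
  show "t0 < t2" using order by simp
  have I_sub: "t \<in> I" if "t0 \<le> t" "t \<le> t2" for t
    using mem_is_interval_1_I[OF hamilton_solutionD(2)[OF sol] I] that by simp
  have nz: "z_of (c t) \<noteq> 0" if "t0 < t" "t < t2" "t \<noteq> t1" for t
  proof
    assume "z_of (c t) = 0"
    then have "t \<in> z_zeros I c \<inter> {t0..t2}" using I_sub[of t] that by (simp add: z_zeros_def)
    then show False unfolding Z using that by simp
  qed
  have dz: "((\<lambda>u. z_of (c u)) has_real_derivative 1/2 * twist (c t)) (at t)" if "t \<in> I" for t
    by (rule hamilton_solution_rsq_z_pz(2)[OF sol that])
  have cont: "continuous_on {a..b} (\<lambda>u. z_of (c u))" if "t0 \<le> a" "b \<le> t2" for a b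
    by (intro continuous_at_imp_continuous_on ballI DERIV_isCont[OF dz] I_sub) (use that in auto)
  \<comment> \<open>Between consecutive zeros z keeps a strict sign, so its derivative cannot have the same strict sign at both.\<close>
  have alternate: "r * twist (c b) \<le> 0"
    if "a < b" "a \<in> I" "b \<in> I" "z_of (c a) = 0" "z_of (c b) = 0" "t0 \<le> a" "b \<le> t2"
      "\<And>t. a < t \<Longrightarrow> t < b \<Longrightarrow> z_of (c t) \<noteq> 0" "0 < r * twist (c a)" "r \<noteq> 0" for a b r
  proof -
    have "r * (1/2 * twist (c b)) \<le> 0"
    proof (rule no_upcrossing_at_next_zero[OF that(1), of "\<lambda>u. r * z_of (c u)"])
      show "((\<lambda>u. r * z_of (c u)) has_real_derivative r * (1/2 * twist (c a))) (at a)"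
        by (rule DERIV_cmult[OF dz[OF that(2)]])
      show "((\<lambda>u. r * z_of (c u)) has_real_derivative r * (1/2 * twist (c b))) (at b)"
        by (rule DERIV_cmult[OF dz[OF that(3)]])
      show "continuous_on {a..b} (\<lambda>u. r * z_of (c u))"
        by (intro continuous_on_mult continuous_on_const cont that)
    qed (use that in auto)
    then show ?thesis by simp
  qed
  have same_sq: "(twist (c t1))\<^sup>2 = (twist (c t0))\<^sup>2" "(twist (c t2))\<^sup>2 = (twist (c t0))\<^sup>2"
    using at_z_zero(2)[OF I(1) z(1)] at_z_zero(2)[OF I(2) z(2)] at_z_zero(2)[OF t1] by simp_all
  show "twist (c t2) = twist (c t0)"
  proof (cases "twist (c t0) = 0")
    case True
    then show ?thesis using same_sq(2) by simp
  next
    case False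
    define r where "r = sgn (twist (c t0))"
    have r: "r \<noteq> 0" "0 < r * twist (c t0)" using False by (auto simp: r_def sgn_if)
    have "r * twist (c t1) \<le> 0"
      by (rule alternate[of t0 t1]) (use order I t1 z nz r in auto)
    moreover have "twist (c t1) \<noteq> 0" using same_sq(1) False by auto
    ultimately have "0 < - r * twist (c t1)" using r(1) by (simp add: less_le)
    then have "- r * twist (c t2) \<le> 0"
      by (intro alternate[of t1 t2]) (use order I t1 z nz r in auto)
    then have "0 \<le> r * twist (c t2)" by simp
    moreover have "twist (c t2) = twist (c t0) \<or> twist (c t2) = - twist (c t0)"
      using same_sq(2) by (simp add: power2_eq_iff)
    ultimately show ?thesis using r(2) by auto
  qed
qed

text \<open>Where \<open>z = 0\<close>, position and twist together with J and P determine all momenta. Hence two such states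
  with the same twist differ by the similarity that matches their positions.\<close>

lemma return_similarity:
  assumes t: "t \<in> I" "z_of (c t) = 0" and u: "u \<in> I" "z_of (c u) = 0"
    and twist: "twist (c u) = twist (c t)"
  shows "\<exists>\<phi>. c u = similarity \<phi> (exp (s_fun (c u) - s_fun (c t))) (c t)"
proof -
  define \<mu> where "\<mu> = exp (s_fun (c u) - s_fun (c t))"
  have \<mu>: "0 < \<mu>" by (simp add: \<mu>_def)
  define x y x' y' R where "x = x_of (c t)" and "y = y_of (c t)" and "x' = x_of (c u)" and "y' = y_of (c u)"
    and "R = rsq (c t)"
  have R: "0 < R" "R = x\<^sup>2 + y\<^sup>2" using rsq_pos[OF t(1)] by (simp_all add: R_def rsq_def x_def y_def)
  have "\<mu>\<^sup>2 = exp (2 * s_fun (c u)) / exp (2 * s_fun (c t))"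
    by (simp add: \<mu>_def exp_diff[symmetric] exp_double[symmetric] right_diff_distrib)
  then have R': "rsq (c u) = \<mu>\<^sup>2 * R"
    using at_z_zero(4)[OF t] at_z_zero(4)[OF u] by (simp add: R_def)
  then have R'': "x'\<^sup>2 + y'\<^sup>2 = \<mu>\<^sup>2 * R" by (simp add: rsq_def x'_def y'_def)
  define C S where "C = (x * x' + y * y') / (\<mu> * R)" and "S = (x * y' - y * x') / (\<mu> * R)"
  have "C\<^sup>2 + S\<^sup>2 = ((x * x' + y * y')\<^sup>2 + (x * y' - y * x')\<^sup>2) / (\<mu> * R)\<^sup>2"
    unfolding C_def S_def power_divide add_divide_distrib[symmetric] ..
  also have "(x * x' + y * y')\<^sup>2 + (x * y' - y * x')\<^sup>2 = R * (x'\<^sup>2 + y'\<^sup>2)"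
    unfolding R(2) by algebra
  also have "\<dots> = (\<mu> * R)\<^sup>2" unfolding R'' by (simp add: power2_eq_square)
  finally have "C\<^sup>2 + S\<^sup>2 = 1" using R(1) \<mu> by simp
  then obtain \<phi> where \<phi>: "C = cos \<phi>" "S = sin \<phi>" using sincos_total_2pi[of C S] by metis
  have CS: "\<mu> * R * C = x * x' + y * y'" "\<mu> * R * S = x * y' - y * x'"
    using R(1) \<mu> by (simp_all add: C_def S_def)
  have "R * x' = R * (\<mu> * (C * x - S * y))"
  proof -
    have "R * (\<mu> * (C * x - S * y)) = (\<mu> * R * C) * x - (\<mu> * R * S) * y" by (simp add: algebra_simps)
    also have "\<dots> = R * x'" unfolding CS unfolding R(2) by algebra
    finally show ?thesis ..
  qed
  then have xx: "x' = \<mu> * (C * x - S * y)" using R(1) by simp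
  have "R * y' = R * (\<mu> * (S * x + C * y))"
  proof -
    have "R * (\<mu> * (S * x + C * y)) = (\<mu> * R * S) * x + (\<mu> * R * C) * y" by (simp add: algebra_simps)
    also have "\<dots> = R * y'" unfolding CS unfolding R(2) by algebra
    finally show ?thesis ..
  qed
  then have yy: "y' = \<mu> * (S * x + C * y)" using R(1) by simp
  \<comment> \<open>On the plane z = 0 the momenta J and P determine the horizontal momentum from the position.\<close>
  have mom: "rsq (c v) * px_of (c v) = x_of (c v) * J - y_of (c v) * P"
    "rsq (c v) * py_of (c v) = y_of (c v) * J + x_of (c v) * P"
    if "v \<in> I" "z_of (c v) = 0" for v
  proof -
    have J: "J = x_of (c v) * px_of (c v) + y_of (c v) * py_of (c v)"
      using at_z_zero(1)[OF that] by (simp add: rad_momentum_def)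
    have P: "P = x_of (c v) * py_of (c v) - y_of (c v) * px_of (c v)"
      using ang[OF that(1)] by (simp add: ang_momentum_def)
    show "rsq (c v) * px_of (c v) = x_of (c v) * J - y_of (c v) * P"
      "rsq (c v) * py_of (c v) = y_of (c v) * J + x_of (c v) * P"
      unfolding J P rsq_def by algebra+
  qed
  define a b where "a = px_of (c t)" and "b = py_of (c t)"
  have ab: "R * a = x * J - y * P" "R * b = y * J + x * P"
    using mom[OF t] by (simp_all add: R_def a_def b_def x_def y_def)
  have "\<mu> * R * (\<mu> * px_of (c u)) = \<mu> * R * (C * a - S * b)"
  proof -
    have "\<mu> * R * (\<mu> * px_of (c u)) = x' * J - y' * P"
      using mom(1)[OF u] by (simp add: R' x'_def y'_def power2_eq_square algebra_simps)
    also have "\<dots> = \<mu> * (C * (x * J - y * P) - S * (y * J + x * P))"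
      unfolding xx yy by algebra
    also have "\<dots> = \<mu> * R * (C * a - S * b)"
      unfolding ab[symmetric] by (simp add: algebra_simps)
    finally show ?thesis .
  qed
  then have "\<mu> * px_of (c u) = C * a - S * b" using R(1) \<mu> by simp
  then have px: "px_of (c u) = (C * a - S * b) / \<mu>" using R(1) \<mu> by (simp add: field_simps)
  have "\<mu> * R * (\<mu> * py_of (c u)) = \<mu> * R * (S * a + C * b)"
  proof -
    have "\<mu> * R * (\<mu> * py_of (c u)) = y' * J + x' * P"
      using mom(2)[OF u] by (simp add: R' x'_def y'_def power2_eq_square algebra_simps)
    also have "\<dots> = \<mu> * (S * (x * J - y * P) + C * (y * J + x * P))"
      unfolding xx yy by algebra
    also have "\<dots> = \<mu> * R * (S * a + C * b)"
      unfolding ab[symmetric] by (simp add: algebra_simps)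
    finally show ?thesis .
  qed
  then have "\<mu> * py_of (c u) = S * a + C * b" using R(1) \<mu> by simp
  then have py: "py_of (c u) = (S * a + C * b) / \<mu>" using R(1) \<mu> by (simp add: field_simps)
  have "rsq (c u) * half_pz (c u) = rsq (c t) * half_pz (c t)"
    using momenta(2)[OF t(1)] momenta(2)[OF u(1)] twist by simp
  then have "\<mu>\<^sup>2 * pz_of (c u) = pz_of (c t)"
    using R(1) by (simp add: R' R_def[symmetric] half_pz_def)
  then have pz: "pz_of (c u) = pz_of (c t) / \<mu>\<^sup>2" using \<mu> by (simp add: field_simps)
  have "c u = similarity \<phi> \<mu> (c t)"
    unfolding phase_eq_iff similarity_coords
    using xx yy px py pz t(2) u(2) by (simp add: \<phi> x_def y_def x'_def y'_def a_def b_def)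
  then show ?thesis unfolding \<mu>_def by blast
qed

text \<open>The states at both times are similar, so the increment of \<open>s\<close> equals that of the Lyapunov function, which
  is strictly monotone at the first of them unless \<open>J = 0\<close>.\<close>

lemma dilation_sign:
  assumes t: "t \<in> I" "z_of (c t) = 0" and u: "u \<in> I" "z_of (c u) = 0" "t < u"
    and twist: "twist (c u) = twist (c t)"
  shows "J = 0 \<Longrightarrow> s_fun (c u) = s_fun (c t)" "J \<noteq> 0 \<Longrightarrow> 0 < J * (s_fun (c u) - s_fun (c t))"
proof -
  obtain V where same: "\<forall>t\<in>I. \<forall>u\<in>I. swing (c t) / scale (c t) = swing (c u) / scale (c u) \<longrightarrow>
          V t - s_fun (c t) = V u - s_fun (c u)"
    and V': "\<forall>t\<in>I. \<exists>v. (V has_real_derivative v) (at t) \<and> 0 \<le> J * v \<and> (J = 0 \<longrightarrow> v = 0) \<and>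
          (z_of (c t) = 0 \<and> J \<noteq> 0 \<longrightarrow> 0 < J * v)"
    using lyapunov_function by blast
  have int: "is_interval I" using hamilton_solutionD(2)[OF sol] .
  have diff: "V u - V t = s_fun (c u) - s_fun (c t)"
    using same t(1) u(1) at_z_zero(3)[OF t] at_z_zero(3)[OF u(1,2)] twist by force
  show "s_fun (c u) = s_fun (c t)" if "J = 0"
  proof -
    have "(V has_real_derivative 0) (at r)" if "r \<in> I" for r
      using V' that \<open>J = 0\<close> by auto
    then show ?thesis
      using constant_on_interval[OF int, of V] t(1) u(1) diff by force
  qed
  show "0 < J * (s_fun (c u) - s_fun (c t))" if nz: "J \<noteq> 0"
  proof -
    obtain v where v: "(V has_real_derivative v) (at t)" "0 < J * v"
      using V' t nz by blast
    obtain d where d: "0 < d" "\<And>h. 0 < h \<Longrightarrow> h < d \<Longrightarrow> J * V t < J * V (t + h)"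
      using DERIV_pos_inc_right[OF DERIV_cmult[OF v(1)] v(2)] by auto
    define h where "h = min (d / 2) (u - t)"
    have h: "0 < h" "h < d" "t + h \<le> u" using d(1) u(3) by (auto simp: h_def)
    have "J * V (t + h) \<le> J * V u"
    proof (rule DERIV_nonneg_imp_nondecreasing[OF h(3)])
      fix r assume "t + h \<le> r" "r \<le> u"
      then have "r \<in> I" using mem_is_interval_1_I[OF int t(1) u(1), of r] h(1) by simp
      then obtain v where "(V has_real_derivative v) (at r)" "0 \<le> J * v" using V' by blast
      then show "\<exists>y. ((\<lambda>r. J * V r) has_real_derivative y) (at r) \<and> 0 \<le> y"
        using DERIV_cmult[of V v r UNIV J] by blast
    qed
    then have "0 < J * (V u - V t)" using d(2)[OF h(1,2)] by (simp add: right_diff_distrib)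
    then show ?thesis unfolding diff .
  qed
qed

text \<open>Self-similarity makes \<open>s\<close> take arbitrarily large and arbitrarily small values, and so does the Lyapunov
  function at bounded distance; being monotone, the latter takes them at the two ends of the interval.\<close>

lemma s_fun_at_ends:
  assumes fwd: "\<And>t. t \<in> I \<Longrightarrow> \<exists>u\<in>I. s_fun (c u) = s_fun (c t) + L"
    and bwd: "\<And>t. t \<in> I \<Longrightarrow> \<exists>u\<in>I. s_fun (c u) = s_fun (c t) - L"
    and "0 < J * L"
  shows "eventually (\<lambda>t. K < J * s_fun (c t)) (future_end I)"
    and "eventually (\<lambda>t. J * s_fun (c t) < K) (past_end I)"
proof -
  obtain V M0 where M0: "\<forall>t\<in>I. \<bar>V t - s_fun (c t)\<bar> \<le> M0"
    and V': "\<forall>t\<in>I. \<exists>v. (V has_real_derivative v) (at t) \<and> 0 \<le> J * v \<and> (J = 0 \<longrightarrow> v = 0) \<and>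
          (z_of (c t) = 0 \<and> J \<noteq> 0 \<longrightarrow> 0 < J * v)"
    using lyapunov_function by blast
  note I = hamilton_solutionD(1-3)[OF sol]
  obtain a where a: "a \<in> I" using I(3) by blast
  define M where "M = \<bar>J\<bar> * M0"
  have close: "\<bar>J * V t - J * s_fun (c t)\<bar> \<le> M" if "t \<in> I" for t
  proof -
    have "\<bar>J * V t - J * s_fun (c t)\<bar> = \<bar>J\<bar> * \<bar>V t - s_fun (c t)\<bar>"
      by (simp add: abs_mult flip: right_diff_distrib)
    also have "\<dots> \<le> M"
      unfolding M_def using M0 that by (intro mult_left_mono) auto
    finally show ?thesis .
  qed
  have mono: "J * V t \<le> J * V u" if "t \<in> I" "u \<in> I" "t \<le> u" for t u
  proof (rule DERIV_nonneg_imp_nondecreasing[OF that(3)])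
    fix r assume "t \<le> r" "r \<le> u"
    then have "r \<in> I" using mem_is_interval_1_I[OF I(2) that(1,2)] by simp
    then obtain v where "(V has_real_derivative v) (at r)" "0 \<le> J * v" using V' by blast
    then show "\<exists>y. ((\<lambda>r. J * V r) has_real_derivative y) (at r) \<and> 0 \<le> y"
      using DERIV_cmult[of V v r UNIV J] by blast
  qed
  have up: "\<exists>t\<in>I. s_fun (c t) = s_fun (c a) + real n * L" for n
  proof (induction n)
    case (Suc n)
    then obtain t where t: "t \<in> I" "s_fun (c t) = s_fun (c a) + real n * L" by blast
    then obtain u where u: "u \<in> I" "s_fun (c u) = s_fun (c t) + L" using fwd by blast
    then have "s_fun (c u) = s_fun (c a) + real (Suc n) * L" using t(2) by (simp add: algebra_simps)
    then show ?case using u(1) by blast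
  qed (use a in auto)
  have down: "\<exists>t\<in>I. s_fun (c t) = s_fun (c a) - real n * L" for n
  proof (induction n)
    case (Suc n)
    then obtain t where t: "t \<in> I" "s_fun (c t) = s_fun (c a) - real n * L" by blast
    then obtain u where u: "u \<in> I" "s_fun (c u) = s_fun (c t) - L" using bwd by blast
    then have "s_fun (c u) = s_fun (c a) - real (Suc n) * L" using t(2) by (simp add: algebra_simps)
    then show ?case using u(1) by blast
  qed (use a in auto)
  show "eventually (\<lambda>t. K < J * s_fun (c t)) (future_end I)"
  proof -
    obtain n where n: "K + 2 * M - J * s_fun (c a) < real n * (J * L)"
      using reals_Archimedean3[OF assms(3)] by blast
    obtain b where b: "b \<in> I" "s_fun (c b) = s_fun (c a) + real n * L" using up by blast
    have "K + 2 * M < J * s_fun (c b)" using n by (simp add: b(2) algebra_simps)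
    then have "K < J * s_fun (c t)" if "t \<in> I" "b < t" for t
      using close[OF that(1)] close[OF b(1)] mono[OF b(1) that(1)] that(2) by linarith
    then show ?thesis unfolding eventually_future_end[OF I] using b(1) by blast
  qed
  show "eventually (\<lambda>t. J * s_fun (c t) < K) (past_end I)"
  proof -
    obtain n where n: "J * s_fun (c a) + 2 * M - K < real n * (J * L)"
      using reals_Archimedean3[OF assms(3)] by blast
    obtain b where b: "b \<in> I" "s_fun (c b) = s_fun (c a) - real n * L" using down by blast
    have "J * s_fun (c b) + 2 * M < K" using n by (simp add: b(2) algebra_simps)
    then have "J * s_fun (c t) < K" if "t \<in> I" "t < b" for t
      using close[OF that(1)] close[OF b(1)] mono[OF that(1) b(1)] that(2) by linarith
    then show ?thesis unfolding eventually_past_end[OF I] using b(1) by blast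
  qed
qed

end

lemma ends_nontrivial:
  assumes "open I" "is_interval I" "I \<noteq> {}"
  shows "future_end I \<noteq> bot" "past_end I \<noteq> bot"
proof -
  have "\<exists>t\<in>I. a < t" "\<exists>t\<in>I. t < a" if a: "a \<in> I" for a
  proof -
    obtain e where e: "0 < e" "ball a e \<subseteq> I" using openE[OF assms(1) a] .
    then have "a + e / 2 \<in> I" "a - e / 2 \<in> I" by (auto simp: dist_real_def subset_iff)
    moreover have "a < a + e / 2" "a - e / 2 < a" using e(1) by auto
    ultimately show "\<exists>t\<in>I. a < t" "\<exists>t\<in>I. t < a" by blast+
  qed
  then show "future_end I \<noteq> bot" "past_end I \<noteq> bot"
    unfolding trivial_limit_def eventually_future_end[OF assms] eventually_past_end[OF assms] by blast+
qed

lemma eventually_in_interval: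
  assumes "open I" "is_interval I" "I \<noteq> {}"
  shows "eventually (\<lambda>t. t \<in> I) (future_end I)" "eventually (\<lambda>t. t \<in> I) (past_end I)"
  using assms(3) unfolding eventually_future_end[OF assms] eventually_past_end[OF assms] by blast+

theorem corollary4p4:
  fixes I :: "real set" and c :: "real \<Rightarrow> phase" and t0 t1 t2 lam :: real
  assumes "A_orbit I c"
    and "consecutive_z_zeros I c t0 t1 t2"
    and "lam = exp (s_fun (c t2) - s_fun (c t0))"
  shows "\<exists>J. (\<forall>t\<in>I. dil_momentum (c t) = J) \<and>
    (J < 0 \<longrightarrow> lam < 1 \<and> future_collision I c \<and> unbounded_in_past I c) \<and>
    (J > 0 \<longrightarrow> lam > 1 \<and> past_collision I c \<and> unbounded_in_future I c) \<and>
    (J = 0 \<longrightarrow> lam = 1 \<and> (periodic_motion I c \<or> quasi_periodic_motion I c))"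
proof -
  have max: "maximal_hamilton_solution I c"
    and energy: "\<And>t. t \<in> I \<Longrightarrow> kh_hamiltonian (c t) = 0"
    and off_axis: "\<And>t. t \<in> I \<Longrightarrow> \<not> (x_of (c t) = 0 \<and> y_of (c t) = 0)"
    using assms(1) unfolding A_orbit_def by blast+
  have sol: "hamilton_solution I c" using max unfolding maximal_hamilton_solution_def by blast
  note I = hamilton_solutionD(1-3)[OF sol]
  obtain J where J: "\<And>t. t \<in> I \<Longrightarrow> dil_momentum (c t) = J"
    using constant_on_interval[OF I(2) dil_momentum_stationary[OF sol _ energy]] by blast
  obtain P where P: "\<And>t. t \<in> I \<Longrightarrow> ang_momentum (c t) = P"
    using constant_on_interval[OF I(2) ang_momentum_stationary[OF sol]] by blast
  interpret zero_energy_motion I c J P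
    using sol energy off_axis J P by unfold_locales
  note ret = twist_returns[OF assms(2)]
  have lam: "0 < lam" "ln lam = s_fun (c t2) - s_fun (c t0)" by (simp_all add: assms(3))
  obtain \<phi> where \<phi>: "c t2 = similarity \<phi> lam (c t0)"
    using return_similarity[OF ret(1,4,2,5,6)] unfolding assms(3) by blast
  \<comment> \<open>The coincidence of two states, spread over the whole motion in both directions of time.\<close>
  have forward: "t2 + lam\<^sup>2 * (t - t0) \<in> I \<and> c (t2 + lam\<^sup>2 * (t - t0)) = similarity \<phi> lam (c t)"
    if "t \<in> I" for t
    by (rule self_similar_motion[OF max lam(1) ret(1,2) \<phi> that])
  have "c t0 = similarity (- \<phi>) (1 / lam) (c t2)"
    unfolding \<phi> similarity_inverse[OF lam(1)] ..
  from self_similar_motion[OF max _ ret(2,1) this] lam(1)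
  have backward: "t0 + (1 / lam)\<^sup>2 * (t - t2) \<in> I \<and>
      c (t0 + (1 / lam)\<^sup>2 * (t - t2)) = similarity (- \<phi>) (1 / lam) (c t)" if "t \<in> I" for t
    using that by simp
  have off0: "fst (c t) \<noteq> 0" if "t \<in> I" for t using hamilton_solutionD(4)[OF sol that] .
  have fwd: "\<exists>u\<in>I. s_fun (c u) = s_fun (c t) + ln lam" if "t \<in> I" for t
    using forward[OF that] s_fun_similarity[OF lam(1) off0[OF that], of \<phi>] by (metis (no_types))
  have bwd: "\<exists>u\<in>I. s_fun (c u) = s_fun (c t) - ln lam" if "t \<in> I" for t
    using backward[OF that] s_fun_similarity[OF _ off0[OF that], of "1 / lam" "- \<phi>"] lam(1)
    by (auto simp: ln_div intro!: bexI[of _ "t0 + (1 / lam)\<^sup>2 * (t - t2)"])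
  have sign: "0 < J * ln lam" if "J \<noteq> 0"
    unfolding lam(2) by (rule dilation_sign(2)[OF ret(1,4,2,5,3,6) that])
  note ends = s_fun_at_ends[OF fwd bwd]
  note nontriv = ends_nontrivial[OF I]
  have off: "eventually (\<lambda>t. fst (c t) \<noteq> 0) (future_end I)" "eventually (\<lambda>t. fst (c t) \<noteq> 0) (past_end I)"
    using eventually_in_interval[OF I] by (auto elim!: eventually_mono simp: off0)
  have neg: "lam < 1 \<and> future_collision I c \<and> unbounded_in_past I c" if "J < 0"
  proof (intro conjI)
    have JL: "0 < J * ln lam" using sign that by simp
    then show "lam < 1" using that lam(1) by (simp add: zero_less_mult_iff)
    have "eventually (\<lambda>t. s_fun (c t) < K) (future_end I)" for K
      using ends(1)[OF _ _ JL, of "J * K"] that by (simp add: mult_less_cancel_left)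
    then show "future_collision I c"
      unfolding future_collision_def by (rule tendsto_origin_of_s_fun[OF off(1)])
    have "eventually (\<lambda>t. K < s_fun (c t)) (past_end I)" for K
      using ends(2)[OF _ _ JL, of "J * K"] that by (simp add: mult_less_cancel_left)
    then show "unbounded_in_past I c"
      unfolding unbounded_in_past_def by (rule not_Bfun_of_s_fun[OF nontriv(2)])
  qed
  have pos: "1 < lam \<and> past_collision I c \<and> unbounded_in_future I c" if "0 < J"
  proof (intro conjI)
    have JL: "0 < J * ln lam" using sign that by simp
    then show "1 < lam" using that lam(1) by (simp add: zero_less_mult_iff)
    have "eventually (\<lambda>t. s_fun (c t) < K) (past_end I)" for K
      using ends(2)[OF _ _ JL, of "J * K"] that by (simp add: mult_less_cancel_left)
    then show "past_collision I c"
      unfolding past_collision_def by (rule tendsto_origin_of_s_fun[OF off(2)])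
    have "eventually (\<lambda>t. K < s_fun (c t)) (future_end I)" for K
      using ends(1)[OF _ _ JL, of "J * K"] that by (simp add: mult_less_cancel_left)
    then show "unbounded_in_future I c"
      unfolding unbounded_in_future_def by (rule not_Bfun_of_s_fun[OF nontriv(1)])
  qed
  have zero: "lam = 1 \<and> (periodic_motion I c \<or> quasi_periodic_motion I c)" if "J = 0"
  proof -
    have lam1: "lam = 1" using dilation_sign(1)[OF ret(1,4,2,5,3,6) that] by (simp add: assms(3))
    have "t + (t2 - t0) \<in> I \<and> c (t + (t2 - t0)) = rotation \<phi> (dilation 1 (c t))" if "t \<in> I" for t
    proof -
      have eq: "t + (t2 - t0) = t2 + lam\<^sup>2 * (t - t0)" by (simp add: lam1)
      show ?thesis using forward[OF that] unfolding eq similarity_def by (simp only: lam1)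
    qed
    then have "quasi_periodic_motion I c"
      unfolding quasi_periodic_motion_def
      by (intro exI[of _ "t2 - t0"] conjI exI[of _ \<phi>] exI[of _ 1]) (use ret(3) in auto)
    then show ?thesis using lam1 by blast
  qed
  show ?thesis
    using J neg pos zero by blast
qed

end
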